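(* Let $\mu\ge1$ be an integer and $\varepsilon>0$. The full avalanche length $L^*_{\mu,\varepsilon}$ for the simple symmetric random walk has probability generating function $$E[z^{L^{*}_{\mu,\varepsilon}}]=\frac{P[T_1>\varepsilon]}{E[1-z^{T_1};T_1\leq\varepsilon]+P[T_1>\varepsilon]},\qquad |z|\le1,$$ where $T_1$ has the probability generating function $$E[z^{T_1}]=A_{\mu}(z)+\frac{B_{\mu}(z)}{1-B_{\mu}(z)}\cdot C_{\mu}(z),\qquad |z|\le 1 .$$
   Context: $(S_n)_{n\ge0}$ is a simple symmetric random walk on $\mathbb{Z}$ with $S_0=0$. The order volume process $V(n,u)$, $n\ge0$, $u\in\mathbb{Z}$, is defined by $V(0,u)=I_{u\ge0}$ and, for $n\ge1$, $V(n,u)=0$ if $u=S_{n-1}$, $V(n,u)=V(n-1,u)+1$ if $u=S_{n-1}+\mu$, and $V(n,u)=V(n-1,u)$ otherwise. Trading times: $\tau_0=0$, $\tau_i=\inf\{n>\tau_{i-1}:V(n,S_n)>0\}$; intertrading times: $T_i=\tau_i-\tau_{i-1}$, $i\ge1$. The full avalanche length is defined by: if $k\ge0$ and $T_1\le\varepsilon,\ldots,T_k\le\varepsilon$, $T_{k+1}>\varepsilon$, then $L^*_{\mu,\varepsilon}=T_1+\cdots+T_k$ (so it equals $0$ if $T_1>\varepsilon$). Notation: $E[X;A]=E[X\,I_A]$. For $n\ge1$ let $\mathbf{U}^{(n)}$ be the set of $(s_0,\ldots,s_n)\in\mathbb{Z}^{n+1}$ with $s_0=0$ and $|s_j-s_{j-1}|=1$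 for $1\le j\le n$. Let $\mathscr{A}_{n,\mu}=\{s\in\mathbf{U}^{(n)}: -\mu<s_k\le0 \text{ for } 0<k\le n-1,\ s_n=1\}$, $\mathscr{B}_{n,\mu}=\{s\in\mathbf{U}^{(n)}: -\mu<s_k\le0 \text{ for } 0<k<n-1,\ s_{n-1}=0,\ s_n=-1\}$, $\mathscr{C}_{n,\mu}=\{s\in\mathscr{A}_{n,\mu}: \min(s_0,\ldots,s_{n-1})=-\mu+1\}$. The corresponding probability generating functions are $A_\mu(z)=\sum_{n\ge1}2^{-n}|\mathscr{A}_{n,\mu}|z^n$, $B_\mu(z)=\sum_{n\ge1}2^{-n}|\mathscr{B}_{n,\mu}|z^n$, $C_\mu(z)=\sum_{n\ge1}2^{-n}|\mathscr{C}_{n,\mu}|z^n$. *)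

theory Defs
  imports "HOL-Probability.Probability"
begin

locale simple_symmetric_random_walk = prob_space M for M :: "'a measure" +
  fixes S :: "nat \<Rightarrow> 'a \<Rightarrow> int"
  assumes start: "\<And>\<omega>. \<omega> \<in> space M \<Longrightarrow> S 0 \<omega> = 0"
    and indep_steps: "indep_vars (\<lambda>_. count_space UNIV) (\<lambda>n \<omega>. S (Suc n) \<omega> - S n \<omega>) UNIV"
    and distr_steps:
      "\<And>n. distr M (count_space UNIV) (\<lambda>\<omega>. S (Suc n) \<omega> - S n \<omega>) = measure_pmf (pmf_of_set {-1, 1})"

text \<open>
  The order volume, the trading times, the intertrading times and the avalanche length are
  defined for a single trajectory \<open>s\<close>; for the random walk they are taken at \<open>\<lambda>n. S n \<omega>\<close>.
\<close>

primrec order_volume :: "int \<Rightarrow> (nat \<Rightarrow> int) \<Rightarrow> nat \<Rightarrow> int \<Rightarrow> nat" where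
  "order_volume \<mu> s 0 u = (if u \<ge> 0 then 1 else 0)"
| "order_volume \<mu> s (Suc n) u =
     (if u = s n then 0
      else if u = s n + \<mu> then order_volume \<mu> s n u + 1
      else order_volume \<mu> s n u)"

text \<open>The infimum of the empty set of times is \<open>\<infinity>\<close>.\<close>

primrec trading_time :: "int \<Rightarrow> (nat \<Rightarrow> int) \<Rightarrow> nat \<Rightarrow> enat" where
  "trading_time \<mu> s 0 = 0"
| "trading_time \<mu> s (Suc i) =
     (INF n \<in> {n. trading_time \<mu> s i < enat n \<and> order_volume \<mu> s n (s n) > 0}. enat n)"

text \<open>
  Only indices \<open>i \<ge> 1\<close> are meaningful. On type \<open>enat\<close> one has \<open>\<infinity> - \<infinity> = \<infinity>\<close>, so the intertrading
  time is \<open>\<infinity>\<close> from the first infinite trading time on.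
\<close>

definition intertrading_time :: "int \<Rightarrow> (nat \<Rightarrow> int) \<Rightarrow> nat \<Rightarrow> enat" where
  "intertrading_time \<mu> s i = trading_time \<mu> s i - trading_time \<mu> s (i - 1)"

definition avalanche_stops :: "int \<Rightarrow> real \<Rightarrow> (nat \<Rightarrow> int) \<Rightarrow> nat \<Rightarrow> bool" where
  "avalanche_stops \<mu> \<epsilon> s k \<longleftrightarrow>
     (\<forall>i\<in>{1..k}. ereal_of_enat (intertrading_time \<mu> s i) \<le> ereal \<epsilon>) \<and>
     ereal_of_enat (intertrading_time \<mu> s (k + 1)) > ereal \<epsilon>"

text \<open>
  At most one \<open>k\<close> satisfies \<open>avalanche_stops\<close>. If there is none, all intertrading times
  are at most \<open>\<epsilon>\<close> and the length is the sum of all of them, \<open>\<infinity>\<close>.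
\<close>

definition full_avalanche_length :: "int \<Rightarrow> real \<Rightarrow> (nat \<Rightarrow> int) \<Rightarrow> enat" where
  "full_avalanche_length \<mu> \<epsilon> s =
     (if \<exists>k. avalanche_stops \<mu> \<epsilon> s k
      then \<Sum>i = 1..(THE k. avalanche_stops \<mu> \<epsilon> s k). intertrading_time \<mu> s i
      else \<infinity>)"

text \<open>
  With \<open>z\<^sup>\<infinity> = 0\<close> also for \<open>\<bar>z\<bar> = 1\<close>, the expectation of \<open>z\<^sup>T\<close> at \<open>z = 1\<close> is the probability
  that \<open>T\<close> is finite.
\<close>

definition enat_power :: "complex \<Rightarrow> enat \<Rightarrow> complex" where
  "enat_power z N = (case N of enat n \<Rightarrow> z ^ n | \<infinity> \<Rightarrow> 0)"

definition paths :: "nat \<Rightarrow> int list set" where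
  "paths n = {s. length s = n + 1 \<and> s ! 0 = 0 \<and> (\<forall>j\<in>{1..n}. \<bar>s ! j - s ! (j - 1)\<bar> = 1)}"

definition paths_A :: "int \<Rightarrow> nat \<Rightarrow> int list set" where
  "paths_A \<mu> n =
     {s \<in> paths n. (\<forall>k. 0 < k \<and> k \<le> n - 1 \<longrightarrow> - \<mu> < s ! k \<and> s ! k \<le> 0) \<and> s ! n = 1}"

definition paths_B :: "int \<Rightarrow> nat \<Rightarrow> int list set" where
  "paths_B \<mu> n =
     {s \<in> paths n. (\<forall>k. 0 < k \<and> k < n - 1 \<longrightarrow> - \<mu> < s ! k \<and> s ! k \<le> 0) \<and>
                   s ! (n - 1) = 0 \<and> s ! n = -1}"

definition paths_C :: "int \<Rightarrow> nat \<Rightarrow> int list set" where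
  "paths_C \<mu> n = {s \<in> paths_A \<mu> n. Min ((\<lambda>k. s ! k) ` {0..n - 1}) = - \<mu> + 1}"

text \<open>The sum runs over path lengths \<open>n \<ge> 1\<close>, hence the shift by \<open>Suc\<close>.\<close>

definition path_gf :: "(nat \<Rightarrow> int list set) \<Rightarrow> complex \<Rightarrow> complex" where
  "path_gf P z = (\<Sum>n. of_nat (card (P (Suc n))) / 2 ^ Suc n * z ^ Suc n)"

definition gf_A :: "int \<Rightarrow> complex \<Rightarrow> complex" where "gf_A \<mu> = path_gf (paths_A \<mu>)"
definition gf_B :: "int \<Rightarrow> complex \<Rightarrow> complex" where "gf_B \<mu> = path_gf (paths_B \<mu>)"
definition gf_C :: "int \<Rightarrow> complex \<Rightarrow> complex" where "gf_C \<mu> = path_gf (paths_C \<mu>)"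

end

theory Submission
  imports Defs
begin

text \<open>
  The levels with positive order volume always form a half-line \<open>{a\<^sub>n..}\<close>. The gap
  \<open>d\<^sub>n = a\<^sub>n - S\<^sub>n\<close> is a Markov chain: clamp it to \<open>[1, \<mu>]\<close>, then subtract the next step
  of the walk. A trade takes place exactly when the gap is \<open>0\<close>, and the half-line then starts at the
  current price, as it does at time \<open>0\<close>. So the future after a trade is a fresh copy of the whole process.

  This renewal turns \<open>\<phi> = E[z\<^sup>L]\<close> into a solution of \<open>\<phi> = q \<phi> + P[T\<^sub>1 > \<epsilon>]\<close> with
  \<open>q = E[z\<^sup>T\<^sup>1; T\<^sub>1 \<le> \<epsilon>]\<close> and \<open>\<bar>q\<bar> < 1\<close>, since \<open>\<epsilon>\<close> consecutive down-steps prevent a trade.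

  First-step analysis gives for \<open>E[z\<^sup>T\<^sup>1]\<close>, as a function of the initial gap, the recurrence
  \<open>f\<^sub>e = (z/2) (f\<^sub>e\<^sub>-\<^sub>1 + f\<^sub>e\<^sub>+\<^sub>1)\<close>, reflected at \<open>\<mu>\<close>. The generating functions \<open>A\<close>, \<open>B\<close> and \<open>C\<close>
  come from the same recurrence, absorbed at the far end: \<open>B = A\<close> by changing the last step, and
  \<open>C\<close> is the difference of \<open>A\<close> for \<open>\<mu>\<close> and \<open>\<mu> - 1\<close> (just \<open>A\<close> if \<open>\<mu> = 1\<close>). The identity between them is a Wronskian
  identity for the two solutions.
\<close>

subsection \<open>Three-term recurrences\<close>

text \<open>
  The parameter \<open>c\<close> encodes the boundary condition \<open>f\<^sub>m\<^sub>+\<^sub>2 = c f\<^sub>m\<^sub>+\<^sub>1\<close> of the recurrence: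
  \<open>0\<close> for absorption, \<open>1\<close> for reflection.
\<close>

fun continuant :: "complex \<Rightarrow> complex \<Rightarrow> nat \<Rightarrow> complex" where
  "continuant c y 0 = 1"
| "continuant c y (Suc 0) = 1 - c * y"
| "continuant c y (Suc (Suc k)) = continuant c y (Suc k) - y\<^sup>2 * continuant c y k"

text \<open>The ratio bound 1/2 reproduces itself, since 1 - (1/4) / (1/2) = 1/2. It makes the later
  denominators nonzero on the whole closed disk, where \<open>y = z / 2\<close>.\<close>

lemma continuant_step_ge:
  assumes y: "norm y \<le> 1/2" and c: "norm c \<le> 1"
  shows "norm (continuant c y (Suc k)) \<ge> norm (continuant c y k) / 2"
proof (induction k)
  case 0
  have "norm (c * y) \<le> 1 * (1/2)"
    unfolding norm_mult using y c by (intro mult_mono) auto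
  moreover have "1 - norm (c * y) \<le> norm (1 - c * y)"
    using norm_triangle_ineq2[of 1 "c * y"] by simp
  ultimately show ?case by simp
next
  case (Suc k)
  let ?K = "continuant c y"
  have "(norm y)\<^sup>2 \<le> (1/2)\<^sup>2"
    using y by (intro power_mono) auto
  then have "norm (y\<^sup>2 * ?K k) \<le> (1/4) * (2 * norm (?K (Suc k)))"
    unfolding norm_mult norm_power using Suc by (intro mult_mono) (auto simp: power2_eq_square)
  moreover have "norm (?K (Suc k)) - norm (y\<^sup>2 * ?K k) \<le> norm (?K (Suc (Suc k)))"
    using norm_triangle_ineq2[of "?K (Suc k)" "y\<^sup>2 * ?K k"] by simp
  ultimately show ?case by simp
qed

lemma continuant_nonzero:
  assumes "norm y \<le> 1/2" and "norm c \<le> 1"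
  shows "continuant c y k \<noteq> 0"
proof (induction k)
  case (Suc k)
  then have "norm (continuant c y (Suc k)) > 0"
    using continuant_step_ge[OF assms, of k] by (smt (verit) zero_less_norm_iff half_gt_zero)
  then show ?case by simp
qed simp

text \<open>Both sides obey the same linear recurrence, so the cases 0 and 1 decide. This later
  gives \<open>1 - gf_B \<mu> z\<close> as a quotient of continuants.\<close>

lemma continuant_one_eq:
  "continuant 1 y (Suc k) = continuant 0 y (Suc k) - y * continuant 0 y k"
proof (induction k rule: induct_nat_012)
  case (ge2 k)
  have "continuant 1 y (Suc (Suc (Suc k))) = continuant 1 y (Suc (Suc k)) - y\<^sup>2 * continuant 1 y (Suc k)"
    by simp
  also have "\<dots> = (continuant 0 y (Suc (Suc k)) - y\<^sup>2 * continuant 0 y (Suc k))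
      - y * (continuant 0 y (Suc k) - y\<^sup>2 * continuant 0 y k)"
    unfolding ge2 by (simp add: algebra_simps del: continuant.simps)
  finally show ?case by simp
qed (auto simp: power2_eq_square)

text \<open>The recurrence multiplies this determinant by \<open>y\<^sup>2\<close> at each step, and
  it equals \<open>y\<close> at \<open>k = 0\<close>.\<close>

lemma continuant_wronskian:
  "continuant 1 y k * continuant 0 y (Suc k) - continuant 0 y k * continuant 1 y (Suc k) = y ^ (2 * k + 1)"
proof (induction k)
  case (Suc k)
  have "continuant 1 y (Suc k) * continuant 0 y (Suc (Suc k))
      - continuant 0 y (Suc k) * continuant 1 y (Suc (Suc k))
    = y\<^sup>2 * (continuant 1 y k * continuant 0 y (Suc k) - continuant 0 y k * continuant 1 y (Suc k))"
    by (simp add: algebra_simps)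
  also have "\<dots> = y ^ (2 * Suc k + 1)"
    unfolding Suc by (simp add: power_add power2_eq_square)
  finally show ?case .
qed simp

text \<open>Cross-multiplied, so that no denominator has to be known to be nonzero.\<close>

lemma harmonic_chain_ratio:
  fixes f :: "nat \<Rightarrow> complex"
  assumes step: "\<And>e. e \<le> m \<Longrightarrow> f (Suc e) = y * (f e + f (Suc (Suc e)))"
    and boundary: "f (Suc (Suc m)) = c * f (Suc m)"
  shows "f 1 * continuant c y (Suc m) = y * f 0 * continuant c y m"
proof -
  \<comment> \<open>Downward induction from the boundary \<open>e = m\<close>: the relation at
    \<open>Suc e\<close> eliminates \<open>f (Suc (Suc e))\<close> and lengthens the continuant by
    one index.\<close>
  have "f (Suc e) * continuant c y (Suc (m - e)) = y * f e * continuant c y (m - e)" if "e \<le> m" for e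
    using that
  proof (induction e rule: inc_induct)
    case base
    show ?case using step[of m] boundary by (simp add: algebra_simps)
  next
    case (step e)
    then have d: "m - e = Suc (m - Suc e)" by simp
    let ?K = "\<lambda>i. continuant c y (i + (m - Suc e))"
    have "f (Suc e) * continuant c y (Suc (m - e)) = f (Suc e) * (?K 1 - y\<^sup>2 * ?K 0)"
      by (simp add: d)
    also have "\<dots> = f (Suc e) * ?K 1 - y * (y * f (Suc e) * ?K 0)"
      by (simp add: algebra_simps power2_eq_square)
    also have "y * f (Suc e) * ?K 0 = f (Suc (Suc e)) * ?K 1"
      using step.IH by simp
    also have "f (Suc e) * ?K 1 - y * (f (Suc (Suc e)) * ?K 1) = (f (Suc e) - y * f (Suc (Suc e))) * ?K 1"
      by (simp add: algebra_simps)
    also have "f (Suc e) - y * f (Suc (Suc e)) = y * f e"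
      using assms(1)[of e] step.hyps by (simp add: algebra_simps)
    finally show ?case by (simp add: d)
  qed
  from this[of 0] show ?thesis by simp
qed

subsection \<open>Counting paths in a strip\<close>

text \<open>The starting level is a parameter so that removing the head gives a recurrence. Levels
  outside the strip are absorbing, and of these only level 1 contributes, with its zero-step
  path.\<close>

primrec exit_paths :: "int \<Rightarrow> nat \<Rightarrow> int \<Rightarrow> int list set" where
  "exit_paths \<mu> 0 x = (if x = 1 then {[1]} else {})"
| "exit_paths \<mu> (Suc n) x =
     (if - \<mu> < x \<and> x \<le> 0 then (#) x ` (exit_paths \<mu> n (x - 1) \<union> exit_paths \<mu> n (x + 1)) else {})"

lemma mem_exit_paths:
  "s \<in> exit_paths \<mu> n x \<longleftrightarrow>
     length s = Suc n \<and> s ! 0 = x \<and>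
     (\<forall>j<n. \<bar>s ! Suc j - s ! j\<bar> = 1 \<and> - \<mu> < s ! j \<and> s ! j \<le> 0) \<and> s ! n = 1"
proof (induction n arbitrary: x s)
  case 0
  show ?case by (cases s) auto
next
  case (Suc n)
  show ?case
  proof (cases s)
    case (Cons a t)
    have "s \<in> exit_paths \<mu> (Suc n) x \<longleftrightarrow>
        - \<mu> < x \<and> x \<le> 0 \<and> a = x \<and> (t \<in> exit_paths \<mu> n (x - 1) \<or> t \<in> exit_paths \<mu> n (x + 1))"
      by (auto simp: Cons)
    also have "\<dots> \<longleftrightarrow> - \<mu> < x \<and> x \<le> 0 \<and> a = x \<and> \<bar>t ! 0 - x\<bar> = 1 \<and> t \<in> exit_paths \<mu> n (t ! 0)"
      by (auto simp: Suc abs_if split: if_splits)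
    finally show ?thesis
      unfolding All_less_Suc2 by (auto simp: Cons Suc)
  qed auto
qed

lemma finite_exit_paths [simp]: "finite (exit_paths \<mu> n x)"
  by (induction n arbitrary: x) auto

lemma card_exit_paths_Suc:
  "card (exit_paths \<mu> (Suc n) x) =
     (if - \<mu> < x \<and> x \<le> 0 then card (exit_paths \<mu> n (x - 1)) + card (exit_paths \<mu> n (x + 1)) else 0)"
proof -
  have "exit_paths \<mu> n (x - 1) \<inter> exit_paths \<mu> n (x + 1) = {}"
    by (auto simp: mem_exit_paths)
  then show ?thesis
    by (auto simp: card_image card_Un_disjoint)
qed

text \<open>The sum is the probability of reaching 1 from \<open>x\<close> in fewer than
  \<open>n\<close> steps without leaving the strip before. The bound gives convergence of the
  generating functions even for \<open>\<bar>z\<bar> = 1\<close>.\<close>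

lemma exit_paths_mass_le:
  "(\<Sum>k<n. real (card (exit_paths \<mu> k x)) / 2 ^ k) \<le> 1"
proof (induction n arbitrary: x)
  case (Suc n)
  let ?m = "\<lambda>x. \<Sum>k<n. real (card (exit_paths \<mu> k x)) / 2 ^ k"
  have "(\<Sum>k<Suc n. real (card (exit_paths \<mu> k x)) / 2 ^ k) =
      real (card (exit_paths \<mu> 0 x)) + (\<Sum>k<n. real (card (exit_paths \<mu> (Suc k) x)) / 2 ^ Suc k)"
    by (subst sum.lessThan_Suc_shift) simp
  also have "\<dots> \<le> 1"
  proof (cases "- \<mu> < x \<and> x \<le> 0")
    case True
    have "(\<Sum>k<n. real (card (exit_paths \<mu> (Suc k) x)) / 2 ^ Suc k) =
        (\<Sum>k<n. (real (card (exit_paths \<mu> k (x - 1))) / 2 ^ k + real (card (exit_paths \<mu> k (x + 1))) / 2 ^ k) / 2)"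
      using True unfolding card_exit_paths_Suc by (intro sum.cong) (simp_all add: add_divide_distrib)
    also have "\<dots> = (?m (x - 1) + ?m (x + 1)) / 2"
      by (simp only: sum.distrib sum_divide_distrib[symmetric])
    finally show ?thesis using True Suc[of "x - 1"] Suc[of "x + 1"] by auto
  next
    case False
    then have "(\<Sum>k<n. real (card (exit_paths \<mu> (Suc k) x)) / 2 ^ Suc k) = 0"
      unfolding card_exit_paths_Suc by (intro sum.neutral) auto
    then show ?thesis by auto
  qed
  finally show ?case .
qed simp

section \<open>Generating functions of the exit paths\<close>

text \<open>Unlike \<open>path_gf\<close> this sums from length 0: that term supplies the boundary
  value 1 at level 1 and vanishes at the origin.\<close>

definition exit_gf :: "int \<Rightarrow> complex \<Rightarrow> int \<Rightarrow> complex" where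
  "exit_gf \<mu> z x = (\<Sum>n. of_nat (card (exit_paths \<mu> n x)) / 2 ^ n * z ^ n)"

lemma summable_exit_gf:
  assumes "norm z \<le> 1"
  shows "summable (\<lambda>n. of_nat (card (exit_paths \<mu> n x)) / 2 ^ n * z ^ n :: complex)"
proof (rule summable_comparison_test)
  show "summable (\<lambda>n. real (card (exit_paths \<mu> n x)) / 2 ^ n)"
    using exit_paths_mass_le[of \<mu> x "Suc _"]
    by (intro bounded_imp_summable[of _ 1]) (auto simp: lessThan_Suc_atMost)
  have "norm (of_nat (card (exit_paths \<mu> n x)) / 2 ^ n * z ^ n :: complex)
      \<le> real (card (exit_paths \<mu> n x)) / 2 ^ n" for n
    unfolding norm_mult norm_divide norm_power
    using assms by (intro order_trans[OF mult_left_le]) (auto simp: power_le_one)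
  then show "\<exists>N. \<forall>n\<ge>N. norm (of_nat (card (exit_paths \<mu> n x)) / 2 ^ n * z ^ n :: complex)
      \<le> real (card (exit_paths \<mu> n x)) / 2 ^ n"
    by blast
qed

lemma exit_gf_outside: "\<not> (- \<mu> < x \<and> x \<le> 0) \<Longrightarrow> exit_gf \<mu> z x = (if x = 1 then 1 else 0)"
proof -
  assume "\<not> (- \<mu> < x \<and> x \<le> 0)"
  then have "(\<lambda>n. of_nat (card (exit_paths \<mu> n x)) / 2 ^ n * z ^ n :: complex) =
      (\<lambda>n. if n = 0 then if x = 1 then 1 else 0 else 0)"
    by (intro ext) (case_tac n; auto)
  then show ?thesis
    unfolding exit_gf_def using suminf_finite[of "{0::nat}" "\<lambda>n. if n = 0 then if x = 1 then 1 else 0 else 0 :: complex"]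
    by simp
qed

lemma exit_gf_harmonic:
  assumes z: "norm z \<le> 1" and x: "- \<mu> < x" "x \<le> 0"
  shows "exit_gf \<mu> z x = z / 2 * (exit_gf \<mu> z (x - 1) + exit_gf \<mu> z (x + 1))"
proof -
  let ?t = "\<lambda>x n. of_nat (card (exit_paths \<mu> n x)) / 2 ^ n * z ^ n :: complex"
  note summ = summable_exit_gf[OF z, of \<mu>]
  have "exit_gf \<mu> z x = ?t x 0 + (\<Sum>n. ?t x (Suc n))"
    unfolding exit_gf_def by (subst suminf_split_head[OF summ]) simp
  also have "?t x 0 = 0" using x by simp
  also have "(\<lambda>n. ?t x (Suc n)) = (\<lambda>n. z / 2 * (?t (x - 1) n + ?t (x + 1) n))"
    using x unfolding card_exit_paths_Suc by (simp add: field_simps)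
  also have "(\<Sum>n. z / 2 * (?t (x - 1) n + ?t (x + 1) n)) = z / 2 * (\<Sum>n. ?t (x - 1) n + ?t (x + 1) n)"
    by (rule suminf_mult) (intro summable_add summ)
  also have "(\<Sum>n. ?t (x - 1) n + ?t (x + 1) n) = exit_gf \<mu> z (x - 1) + exit_gf \<mu> z (x + 1)"
    unfolding exit_gf_def by (rule suminf_add[symmetric]; rule summ)
  finally show ?thesis by simp
qed

lemma exit_gf_origin:
  assumes z: "norm z \<le> 1"
  shows "exit_gf (int (Suc m)) z 0 = z / 2 * continuant 0 (z / 2) m / continuant 0 (z / 2) (Suc m)"
proof -
  \<comment> \<open>The index is the distance below the exit level 1. At
    \<open>e = Suc (Suc m)\<close> the level is \<open>- int (Suc m)\<close>, where absorption gives
    \<open>c = 0\<close>.\<close>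
  define f where "f e = exit_gf (int (Suc m)) z (1 - int e)" for e
  have "f 1 * continuant 0 (z / 2) (Suc m) = z / 2 * f 0 * continuant 0 (z / 2) m"
  proof (rule harmonic_chain_ratio)
    fix e assume "e \<le> m"
    have "f (Suc e) = exit_gf (int (Suc m)) z (- int e)"
      by (simp add: f_def)
    also have "\<dots> = z / 2 * (exit_gf (int (Suc m)) z (- int e - 1) + exit_gf (int (Suc m)) z (- int e + 1))"
      using \<open>e \<le> m\<close> by (intro exit_gf_harmonic z) simp_all
    also have "- int e - 1 = 1 - int (Suc (Suc e))" by simp
    also have "- int e + 1 = 1 - int e" by simp
    finally show "f (Suc e) = z / 2 * (f e + f (Suc (Suc e)))"
      unfolding f_def by (simp only: add.commute)
  qed (simp add: f_def exit_gf_outside)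
  moreover have "f 0 = 1" "f 1 = exit_gf (int (Suc m)) z 0"
    by (simp_all add: f_def exit_gf_outside)
  moreover have "continuant 0 (z / 2) (Suc m) \<noteq> 0"
    using z by (intro continuant_nonzero) (auto simp: norm_divide)
  ultimately show ?thesis by (simp add: field_simps)
qed

section \<open>The path classes A, B and C in terms of exit paths\<close>

lemma mem_paths_A:
  assumes "\<mu> \<ge> 1"
  shows "s \<in> paths_A \<mu> n \<longleftrightarrow> s \<in> exit_paths \<mu> n 0"
proof -
  have steps: "(\<forall>j\<in>{1..n}. \<bar>s ! j - s ! (j - 1)\<bar> = 1) \<longleftrightarrow> (\<forall>j<n. \<bar>s ! Suc j - s ! j\<bar> = 1)"
    by (subst image_Suc_lessThan[symmetric]) auto
  \<comment> \<open>\<open>paths_A\<close> leaves time 0 out of the strip condition; there it holds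
    because the start 0 lies in the strip for \<open>\<mu> \<ge> 1\<close>.\<close>
  have strip: "(\<forall>k. 0 < k \<and> k \<le> n - 1 \<longrightarrow> - \<mu> < s ! k \<and> s ! k \<le> 0) \<longleftrightarrow>
      (\<forall>k<n. - \<mu> < s ! k \<and> s ! k \<le> 0)" if "s ! 0 = 0"
  proof (intro iffI allI impI)
    fix k assume "\<forall>k. 0 < k \<and> k \<le> n - 1 \<longrightarrow> - \<mu> < s ! k \<and> s ! k \<le> 0" "k < n"
    then show "- \<mu> < s ! k \<and> s ! k \<le> 0"
      using that assms by (cases "k = 0") auto
  qed auto
  show ?thesis
    unfolding paths_A_def paths_def mem_exit_paths mem_Collect_eq steps
    using strip by auto
qed

lemma paths_A_eq: "\<mu> \<ge> 1 \<Longrightarrow> paths_A \<mu> n = exit_paths \<mu> n 0"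
  using mem_paths_A by blast

lemma path_gf_exit_paths:
  assumes "norm z \<le> 1"
  shows "path_gf (\<lambda>n. exit_paths \<mu> n 0) z = exit_gf \<mu> z 0"
  unfolding exit_gf_def path_gf_def
  by (subst suminf_split_head[OF summable_exit_gf[OF assms]]) simp

lemma gf_A_eq:
  assumes "\<mu> \<ge> 1" "norm z \<le> 1"
  shows "gf_A \<mu> z = exit_gf \<mu> z 0"
  unfolding gf_A_def paths_A_eq[OF assms(1), abs_def] by (rule path_gf_exit_paths[OF assms(2)])

text \<open>A path in A stands at 0 just before its last step, being at most 0 there and one step
  away from 1. Turning the last step downwards is therefore a bijection onto B.\<close>

lemma card_paths_B:
  assumes "\<mu> \<ge> 1"
  shows "card (paths_B \<mu> (Suc n)) = card (paths_A \<mu> (Suc n))"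
proof -
  define turn :: "int \<Rightarrow> int list \<Rightarrow> int list" where "turn v s = s[Suc n := v]" for v s
  have nth_turn: "turn v s ! k = (if k = Suc n then v else s ! k)" if "length s = n + 2" for v s k
    using that by (simp add: turn_def nth_list_update)
  have penult: "s ! n = 0" if "s \<in> paths_A \<mu> (Suc n)" for s
  proof -
    have "s ! n \<le> 0" "\<bar>s ! Suc n - s ! n\<bar> = 1" "s ! Suc n = 1"
      using that unfolding mem_paths_A[OF assms] mem_exit_paths by auto
    then show ?thesis by linarith
  qed
  have strip: "(\<forall>k. 0 < k \<and> k \<le> Suc n - 1 \<longrightarrow> - \<mu> < s ! k \<and> s ! k \<le> 0) \<longleftrightarrow>
      (\<forall>k. 0 < k \<and> k < Suc n - 1 \<longrightarrow> - \<mu> < s ! k \<and> s ! k \<le> 0)" if "s ! n = 0" for s :: "int list"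
    using that assms by (auto simp: le_less)
  have path: "turn v s \<in> paths (Suc n) \<longleftrightarrow> s \<in> paths (Suc n)"
    if "length s = n + 2" "s ! n = 0" "\<bar>s ! Suc n\<bar> = 1" "\<bar>v\<bar> = 1" for v s
  proof -
    have "(\<forall>j\<in>{1..n}. \<bar>turn v s ! j - turn v s ! (j - 1)\<bar> = 1) \<longleftrightarrow> (\<forall>j\<in>{1..n}. \<bar>s ! j - s ! (j - 1)\<bar> = 1)"
      by (rule ball_cong) (auto simp: nth_turn[OF that(1)])
    moreover have "{1..Suc n} = insert (Suc n) {1..n}" by auto
    moreover have "length (turn v s) = length s" by (simp add: turn_def)
    ultimately show ?thesis
      using that by (simp add: paths_def nth_turn[OF that(1)])
  qed
  have "bij_betw (turn (- 1)) (paths_A \<mu> (Suc n)) (paths_B \<mu> (Suc n))"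
  proof (rule bij_betw_byWitness[where f' = "turn 1"])
    show "turn (- 1) ` paths_A \<mu> (Suc n) \<subseteq> paths_B \<mu> (Suc n)"
    proof safe
      fix s assume s: "s \<in> paths_A \<mu> (Suc n)"
      then have len: "length s = n + 2" by (simp add: paths_A_def paths_def)
      have "turn (- 1) s \<in> paths (Suc n)"
        using s penult[OF s] len path[of s "-1"] by (auto simp: paths_A_def)
      then show "turn (- 1) s \<in> paths_B \<mu> (Suc n)"
        using s penult[OF s] len by (auto simp: paths_A_def paths_B_def nth_turn)
    qed
    show "turn 1 ` paths_B \<mu> (Suc n) \<subseteq> paths_A \<mu> (Suc n)"
    proof safe
      fix s assume s: "s \<in> paths_B \<mu> (Suc n)"
      then have len: "length s = n + 2" by (simp add: paths_B_def paths_def)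
      have "turn 1 s \<in> paths (Suc n)"
        using s len path[of s 1] by (auto simp: paths_B_def)
      moreover have "\<forall>k. 0 < k \<and> k \<le> Suc n - 1 \<longrightarrow> - \<mu> < s ! k \<and> s ! k \<le> 0"
        using s strip[of s] by (auto simp: paths_B_def)
      ultimately show "turn 1 s \<in> paths_A \<mu> (Suc n)"
        using len by (auto simp: paths_A_def nth_turn)
    qed
  qed (auto simp: paths_A_def paths_B_def paths_def turn_def intro!: list_update_same_conv[THEN iffD2])
  then show ?thesis
    by (simp add: bij_betw_same_card)
qed

lemma gf_B_eq: "\<mu> \<ge> 1 \<Longrightarrow> gf_B \<mu> z = gf_A \<mu> z"
  unfolding gf_A_def gf_B_def path_gf_def by (simp add: card_paths_B)

text \<open>A path in the strip has minimum at least \<open>- \<mu> + 1\<close>, and equality fails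
  exactly when it stays in the strip that is one level narrower.\<close>

lemma paths_C_eq:
  assumes "\<mu> \<ge> 2"
  shows "paths_C \<mu> (Suc n) = exit_paths \<mu> (Suc n) 0 - exit_paths (\<mu> - 1) (Suc n) 0"
proof -
  have "Min ((\<lambda>k. s ! k) ` {0..n}) = - \<mu> + 1 \<longleftrightarrow> s \<notin> exit_paths (\<mu> - 1) (Suc n) 0"
    if s: "s \<in> exit_paths \<mu> (Suc n) 0" for s
  proof -
    have *: "- \<mu> + 1 \<le> s ! k" if "k \<le> n" for k
    proof -
      have "- \<mu> < s ! k"
        using s that by (simp add: mem_exit_paths less_Suc_eq_le del: exit_paths.simps)
      then show ?thesis by simp
    qed
    have "Min ((\<lambda>k. s ! k) ` {0..n}) = - \<mu> + 1 \<longleftrightarrow> - \<mu> + 1 \<in> (\<lambda>k. s ! k) ` {0..n}"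
      using * by (subst Min_eq_iff) auto
    also have "\<dots> \<longleftrightarrow> (\<exists>k\<le>n. s ! k = - \<mu> + 1)"
      by (force simp: image_iff)
    also have "\<dots> \<longleftrightarrow> \<not> (\<forall>k\<le>n. - \<mu> + 1 < s ! k)"
      using * by (metis less_irrefl less_le)
    also have "\<dots> \<longleftrightarrow> s \<notin> exit_paths (\<mu> - 1) (Suc n) 0"
      using s by (auto simp: mem_exit_paths less_Suc_eq_le simp del: exit_paths.simps)
    finally show ?thesis .
  qed
  then show ?thesis
    using assms by (auto simp: paths_C_def paths_A_eq)
qed

lemma gf_C_eq:
  assumes mu: "\<mu> \<ge> 1" and z: "norm z \<le> 1"
  shows "gf_C \<mu> z = exit_gf \<mu> z 0 - (if \<mu> = 1 then 0 else exit_gf (\<mu> - 1) z 0)"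
proof (cases "\<mu> = 1")
  case True
  have "paths_C 1 (Suc n) = exit_paths 1 (Suc n) 0" for n
  proof -
    \<comment> \<open>For \<open>\<mu> = 1\<close> the strip is the single level 0, so the minimum
      condition of C holds automatically.\<close>
    have "(\<lambda>k. s ! k) ` {0..n} = {0}" if "s \<in> exit_paths 1 (Suc n) 0" for s
      using that by (force simp: mem_exit_paths)
    then show ?thesis
      by (auto simp: paths_C_def paths_A_eq)
  qed
  then show ?thesis
    using True path_gf_exit_paths[OF z, of 1] by (simp add: gf_C_def path_gf_def)
next
  case False
  with mu have mu2: "\<mu> \<ge> 2" by simp
  have sub: "exit_paths (\<mu> - 1) n 0 \<subseteq> exit_paths \<mu> n 0" for n
    by (force simp: mem_exit_paths)
  have summ: "summable (\<lambda>n. of_nat (card (exit_paths \<nu> (Suc n) 0)) / 2 ^ Suc n * z ^ Suc n :: complex)" for \<nu>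
    using summable_exit_gf[OF z, of \<nu> 0] by (subst summable_Suc_iff)
  have "gf_C \<mu> z = path_gf (\<lambda>n. exit_paths \<mu> n 0) z - path_gf (\<lambda>n. exit_paths (\<mu> - 1) n 0) z"
    unfolding gf_C_def path_gf_def paths_C_eq[OF mu2]
    by (subst suminf_diff[OF summ summ])
       (simp add: card_Diff_subset sub card_mono of_nat_diff diff_divide_distrib left_diff_distrib
          del: exit_paths.simps power_Suc)
  then show ?thesis
    using False z by (simp add: path_gf_exit_paths)
qed

text \<open>After expressing A, B and C by continuants, the left side has, up to the factor
  \<open>y\<close>, the numerator \<open>p m * q (Suc m) + y ^ (2 * m + 1)\<close>. The Wronskian
  turns it into \<open>q m * p (Suc m)\<close>, and \<open>p (Suc m)\<close> cancels.\<close>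

lemma avalanche_gf_identity:
  assumes mu: "\<mu> = int (Suc m)" and z: "norm z \<le> 1"
  shows "gf_A \<mu> z + gf_B \<mu> z / (1 - gf_B \<mu> z) * gf_C \<mu> z =
    z / 2 * continuant 1 (z / 2) m / continuant 1 (z / 2) (Suc m)"
proof -
  define y where "y = z / 2"
  define p where "p = continuant 0 y"
  define q where "q = continuant 1 y"
  have "norm y \<le> 1/2" using z by (simp add: y_def norm_divide)
  then have nz: "p k \<noteq> 0" "q k \<noteq> 0" for k
    by (simp_all add: p_def q_def continuant_nonzero)
  have q_Suc: "q (Suc k) = p (Suc k) - y * p k" for k
    unfolding p_def q_def by (rule continuant_one_eq)
  have wronskian: "q k * p (Suc k) - p k * q (Suc k) = y ^ (2 * k + 1)" for k
    unfolding p_def q_def by (rule continuant_wronskian)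
  have A: "gf_A \<mu> z = y * p m / p (Suc m)"
    using mu z by (simp add: gf_A_eq exit_gf_origin y_def p_def del: of_nat_Suc continuant.simps)
  have C: "gf_C \<mu> z = y ^ (2 * m + 1) / (p m * p (Suc m))"
  proof (cases m)
    case 0
    then show ?thesis
      using gf_C_eq[of \<mu> z] gf_A_eq[of \<mu> z] mu z A by (simp add: p_def)
  next
    case (Suc k)
    have "gf_C \<mu> z = y * p m / p (Suc m) - y * p k / p m"
      using gf_C_eq[of \<mu> z] gf_A_eq[of \<mu> z] mu z A exit_gf_origin[OF z, of k]
      by (simp add: Suc y_def p_def del: continuant.simps)
    also have "\<dots> = (y * p m * p m - y * p k * p (Suc m)) / (p m * p (Suc m))"
      using nz by (simp add: field_simps)
    \<comment> \<open>Substituting \<open>q_Suc\<close> in both terms of the Wronskian cancels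
      \<open>p m * p (Suc m)\<close> and leaves exactly this difference.\<close>
    also have "y * p m * p m - y * p k * p (Suc m) = y ^ (2 * m + 1)"
      unfolding wronskian[of m, symmetric] unfolding Suc q_Suc by (simp add: algebra_simps)
    finally show ?thesis .
  qed
  have "1 - gf_B \<mu> z = q (Suc m) / p (Suc m)"
    using nz mu A by (simp add: gf_B_eq q_Suc diff_divide_distrib)
  then have ratio: "gf_B \<mu> z / (1 - gf_B \<mu> z) = y * p m / q (Suc m)"
    using nz mu A by (simp add: gf_B_eq)
  have "gf_A \<mu> z + gf_B \<mu> z / (1 - gf_B \<mu> z) * gf_C \<mu> z
      = y * (p m * q (Suc m) + y ^ (2 * m + 1)) / (p (Suc m) * q (Suc m))"
    unfolding ratio A C using nz by (simp add: field_simps)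
  also have "\<dots> = y * q m / q (Suc m)"
    unfolding wronskian[of m, symmetric] using nz by (simp add: field_simps)
  finally show ?thesis by (simp add: y_def q_def)
qed

subsection \<open>The gap process\<close>

definition walk :: "(nat \<Rightarrow> int) \<Rightarrow> nat \<Rightarrow> int" where
  "walk x n = (\<Sum>i<n. x i)"

lemma walk_0 [simp]: "walk x 0 = 0"
  and walk_Suc [simp]: "walk x (Suc n) = walk x n + x n"
  by (simp_all add: walk_def)

lemma walk_add: "walk x (t + n) = walk x t + walk (\<lambda>i. x (t + i)) n"
  by (induction n) auto

text \<open>Clamping is the update of the order book: emptying the current level raises a gap 0 to
  1, and a new order at distance \<open>\<mu>\<close> lowers a gap \<open>\<mu> + 1\<close> to
  \<open>\<mu>\<close>. The initial gap is free for the sake of first-step analysis.\<close>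

primrec gap :: "int \<Rightarrow> int \<Rightarrow> (nat \<Rightarrow> int) \<Rightarrow> nat \<Rightarrow> int" where
  "gap \<mu> d x 0 = d"
| "gap \<mu> d x (Suc n) = min (max (gap \<mu> d x n) 1) \<mu> - x n"

lemma gap_case_nat: "gap \<mu> d (case_nat y x) (Suc n) = gap \<mu> (min (max d 1) \<mu> - y) x n"
  by (induction n) auto

text \<open>The bounds belong to the induction: a new order at distance \<open>\<mu>\<close> leaves
  no hole in the half-line only because the gap is at most \<open>\<mu> + 1\<close>.\<close>

lemma order_volume_pos_iff:
  assumes mu: "\<mu> \<ge> 1" and x: "\<And>n. \<bar>x n\<bar> = 1"
  shows "0 \<le> gap \<mu> 0 x n \<and> gap \<mu> 0 x n \<le> \<mu> + 1 \<and>
    (\<forall>v. order_volume \<mu> (walk x) n v > 0 \<longleftrightarrow> walk x n + gap \<mu> 0 x n \<le> v)"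
proof (induction n)
  case 0
  show ?case using mu by simp
next
  case (Suc n)
  let ?g = "gap \<mu> 0 x n" and ?w = "walk x n"
  have g: "0 \<le> ?g" "?g \<le> \<mu> + 1"
    and V: "\<And>v. order_volume \<mu> (walk x) n v > 0 \<longleftrightarrow> ?w + ?g \<le> v"
    using Suc by auto
  have "x n \<in> {-1, 1}" using x[of n] by (auto simp: abs_if split: if_splits)
  then have "0 \<le> gap \<mu> 0 x (Suc n)" "gap \<mu> 0 x (Suc n) \<le> \<mu> + 1"
    using mu by (auto simp: min_def max_def)
  moreover have "order_volume \<mu> (walk x) (Suc n) v > 0 \<longleftrightarrow> walk x (Suc n) + gap \<mu> 0 x (Suc n) \<le> v" for v
  proof -
    have "order_volume \<mu> (walk x) (Suc n) v > 0 \<longleftrightarrow> v \<noteq> ?w \<and> (v = ?w + \<mu> \<or> ?w + ?g \<le> v)"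
      using V[of v] by simp
    also have "\<dots> \<longleftrightarrow> ?w + min (max ?g 1) \<mu> \<le> v"
      using g mu by (cases "?g = 0") (auto simp: min_def max_def)
    finally show ?thesis by simp
  qed
  ultimately show ?case by blast
qed

lemma order_volume_at_walk_pos_iff:
  assumes "\<mu> \<ge> 1" and "\<And>n. \<bar>x n\<bar> = 1"
  shows "order_volume \<mu> (walk x) n (walk x n) > 0 \<longleftrightarrow> gap \<mu> 0 x n = 0"
  using order_volume_pos_iff[of \<mu> x n, OF assms] by auto

lemma INF_enat_mem: "K \<noteq> {} \<Longrightarrow> (INF k\<in>K. enat k) \<in> enat ` K"
  unfolding Inf_enat_def by (auto intro: LeastI)

lemma enat_add_INF: "enat t + (INF k\<in>K. enat k) = (INF k\<in>K. enat (t + k))"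
proof (cases "K = {}")
  case True
  then show ?thesis by (simp add: top_enat_def)
next
  case False
  from INF_enat_mem[OF this] obtain k where k: "k \<in> K" "(INF k\<in>K. enat k) = enat k" by auto
  show ?thesis
  proof (rule antisym)
    show "enat t + (INF k\<in>K. enat k) \<le> (INF k\<in>K. enat (t + k))"
    proof (rule INF_greatest)
      fix k assume "k \<in> K"
      then show "enat t + (INF k\<in>K. enat k) \<le> enat (t + k)"
        unfolding plus_enat_simps(1)[symmetric] by (intro add_left_mono INF_lower)
    qed
    show "(INF k\<in>K. enat (t + k)) \<le> enat t + (INF k\<in>K. enat k)"
      using k by (auto intro!: INF_lower2[of k])
  qed
qed

text \<open>This extends the first intertrading time to any initial gap. The condition
  \<open>0 < n\<close> matters for \<open>d = 0\<close>, where time 0 must not count.\<close>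

definition first_trade :: "int \<Rightarrow> int \<Rightarrow> (nat \<Rightarrow> int) \<Rightarrow> enat" where
  "first_trade \<mu> d x = (INF n\<in>{n. 0 < n \<and> gap \<mu> d x n = 0}. enat n)"

text \<open>Shifting by one step removes the condition \<open>0 < n\<close>, so the shifted set
  contains 0 exactly when the first step already leads to a trade.\<close>

lemma first_trade_case_nat:
  "first_trade \<mu> d (case_nat y x) =
     (if min (max d 1) \<mu> = y then 1 else eSuc (first_trade \<mu> (min (max d 1) \<mu> - y) x))"
proof -
  let ?d = "min (max d 1) \<mu> - y"
  have "{n. 0 < n \<and> gap \<mu> d (case_nat y x) n = 0} = Suc ` {n. gap \<mu> ?d x n = 0}"
    by (auto simp: image_iff gr0_conv_Suc gap_case_nat simp del: gap.simps(2))
  then have "first_trade \<mu> d (case_nat y x) = (INF n\<in>{n. gap \<mu> ?d x n = 0}. enat (1 + n))"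
    by (simp add: first_trade_def image_comp)
  also have "\<dots> = enat 1 + (INF n\<in>{n. gap \<mu> ?d x n = 0}. enat n)"
    by (rule enat_add_INF[symmetric])
  finally have *: "first_trade \<mu> d (case_nat y x) = eSuc (INF n\<in>{n. gap \<mu> ?d x n = 0}. enat n)"
    by (simp only: plus_1_eSuc one_enat_def[symmetric])
  show ?thesis
  proof (cases "?d = 0")
    case True
    then have "(INF n\<in>{n. gap \<mu> ?d x n = 0}. enat n) \<le> enat 0"
      by (intro INF_lower) simp
    then show ?thesis using True by (simp add: * enat_0 one_eSuc)
  next
    case False
    then have "{n. gap \<mu> ?d x n = 0} = {n. 0 < n \<and> gap \<mu> ?d x n = 0}"
      by (metis gap.simps(1) gr_zeroI)
    then show ?thesis using False by (simp add: * first_trade_def[of _ ?d x])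
  qed
qed

text \<open>The initial gap acts only through its clamped value. So gap 0 behaves like 1, and
  \<open>\<mu> + 1\<close> like \<open>\<mu>\<close>, which is the later reflection.\<close>

lemma first_trade_clamp:
  assumes "\<mu> \<ge> 1" shows "first_trade \<mu> (min (max d 1) \<mu>) x = first_trade \<mu> d x"
proof -
  obtain y x' where "x = case_nat y x'"
  proof
    show "x = case_nat (x 0) (\<lambda>n. x (Suc n))" by (auto split: nat.split)
  qed
  moreover have "min (max (min (max d 1) \<mu>) 1) \<mu> = min (max d 1) \<mu>" using assms by auto
  ultimately show ?thesis by (simp only: first_trade_case_nat)
qed

lemma intertrading_time_1:
  assumes "\<mu> \<ge> 1" and "\<And>n. \<bar>x n\<bar> = 1"
  shows "intertrading_time \<mu> (walk x) 1 = first_trade \<mu> 0 x"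
  using order_volume_at_walk_pos_iff[OF assms]
  by (simp add: intertrading_time_def first_trade_def enat_0_iff zero_enat_def)

subsection \<open>Renewal at the first trade\<close>

context
  fixes \<mu> :: int and x :: "nat \<Rightarrow> int" and t :: nat
  assumes mu: "\<mu> \<ge> 1" and unit: "\<And>n. \<bar>x n\<bar> = 1"
    and t: "first_trade \<mu> 0 x = enat t"
begin

lemma gap_at_first_trade: "gap \<mu> 0 x t = 0" and first_trade_pos: "t > 0"
proof -
  let ?K = "{n. 0 < n \<and> gap \<mu> 0 x n = 0}"
  have "?K \<noteq> {}"
  proof
    assume "?K = {}"
    then show False using t unfolding first_trade_def by (simp only:) (simp add: top_enat_def)
  qed
  then have "first_trade \<mu> 0 x \<in> enat ` ?K"
    unfolding first_trade_def by (rule INF_enat_mem)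
  then show "gap \<mu> 0 x t = 0" "t > 0" using t by auto
qed

text \<open>Only positivity restarts: at time \<open>t\<close> volumes may exceed 1, whereas a fresh
  start has volume 1. Positivity after an update depends only on positivity before it, and the
  update is translation invariant.\<close>

lemma order_volume_renewal:
  "order_volume \<mu> (walk x) (t + n) v > 0 \<longleftrightarrow>
   order_volume \<mu> (walk (\<lambda>i. x (t + i))) n (v - walk x t) > 0"
proof (induction n arbitrary: v)
  case 0
  show ?case using order_volume_pos_iff[of \<mu> x t, OF mu unit] gap_at_first_trade by simp
next
  case (Suc n)
  then show ?case by (auto simp: walk_add)
qed

text \<open>Trading times see volumes only through positivity. From index 1 on they are at least
  \<open>t\<close>, so the candidates for the next one are the shifted candidates of the restarted
  walk.\<close>

lemma trading_time_renewal:
  "trading_time \<mu> (walk x) (Suc j) = enat t + trading_time \<mu> (walk (\<lambda>i. x (t + i))) j"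
proof (induction j)
  case 0
  have "trading_time \<mu> (walk x) (Suc 0) = enat t"
    using intertrading_time_1[OF mu unit] t by (simp add: intertrading_time_def del: trading_time.simps(2))
  then show ?case by (simp del: trading_time.simps(2))
next
  case (Suc j)
  let ?s = "walk x" and ?s' = "walk (\<lambda>i. x (t + i))"
  let ?K = "{k. trading_time \<mu> ?s' j < enat k \<and> order_volume \<mu> ?s' k (?s' k) > 0}"
  have "{n. trading_time \<mu> ?s (Suc j) < enat n \<and> order_volume \<mu> ?s n (?s n) > 0} = (\<lambda>k. t + k) ` ?K"
  proof (intro set_eqI iffI)
    fix n assume n: "n \<in> {n. trading_time \<mu> ?s (Suc j) < enat n \<and> order_volume \<mu> ?s n (?s n) > 0}"
    then have "enat t + trading_time \<mu> ?s' j < enat n" using Suc by simp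
    then have "t \<le> n" by (cases "trading_time \<mu> ?s' j") auto
    then obtain k where k: "n = t + k" by (metis le_iff_add)
    have "trading_time \<mu> ?s' j < enat k"
      using \<open>enat t + trading_time \<mu> ?s' j < enat n\<close> k by (cases "trading_time \<mu> ?s' j") auto
    moreover have "order_volume \<mu> ?s' k (?s' k) > 0"
      using n order_volume_renewal[of k "?s n"] by (simp add: k walk_add)
    ultimately show "n \<in> (\<lambda>k. t + k) ` ?K" using k by auto
  next
    fix n assume "n \<in> (\<lambda>k. t + k) ` ?K"
    then obtain k where k: "n = t + k" "trading_time \<mu> ?s' j < enat k" "order_volume \<mu> ?s' k (?s' k) > 0"
      by auto
    have "enat t + trading_time \<mu> ?s' j < enat n"
      using k by (cases "trading_time \<mu> ?s' j") auto
    moreover have "order_volume \<mu> ?s n (?s n) > 0"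
      using k order_volume_renewal[of k "?s n"] by (simp add: walk_add)
    ultimately show "n \<in> {n. trading_time \<mu> ?s (Suc j) < enat n \<and> order_volume \<mu> ?s n (?s n) > 0}"
      using Suc by simp
  qed
  then have "trading_time \<mu> ?s (Suc (Suc j)) = (INF k\<in>?K. enat (t + k))"
    by (simp only: trading_time.simps(2)[of _ _ "Suc j"] image_comp comp_def)
  also have "\<dots> = enat t + (INF k\<in>?K. enat k)"
    by (rule enat_add_INF[symmetric])
  finally show ?case by simp
qed

lemma intertrading_time_renewal:
  assumes "i > 0"
  shows "intertrading_time \<mu> (walk x) (Suc i) = intertrading_time \<mu> (walk (\<lambda>i. x (t + i))) i"
proof -
  obtain j where j: "i = Suc j" using assms by (cases i) auto
  \<comment> \<open>Here \<open>t\<close> is finite, so it cancels; for infinite \<open>a\<close>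
    both differences are infinite.\<close>
  have "(enat t + a) - (enat t + b) = a - b" for a b
    by (cases a; cases b) auto
  then show ?thesis
    unfolding intertrading_time_def j using trading_time_renewal by (simp del: trading_time.simps(2))
qed

lemma avalanche_stops_renewal:
  "avalanche_stops \<mu> \<epsilon> (walk x) (Suc k) \<longleftrightarrow>
     ereal_of_enat (enat t) \<le> ereal \<epsilon> \<and> avalanche_stops \<mu> \<epsilon> (walk (\<lambda>i. x (t + i))) k"
proof -
  have "(\<forall>i\<in>{1..Suc k}. P i) \<longleftrightarrow> P 1 \<and> (\<forall>i\<in>{1..k}. P (Suc i))" for P :: "nat \<Rightarrow> bool"
    by (induction k) (auto simp: atLeastAtMostSuc_conv)
  then show ?thesis
    unfolding avalanche_stops_def using intertrading_time_1[OF mu unit] t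
    by (auto simp: intertrading_time_renewal)
qed

end

section \<open>The avalanche length along a trajectory\<close>

lemma avalanche_stops_unique:
  assumes "avalanche_stops \<mu> \<epsilon> s k" "avalanche_stops \<mu> \<epsilon> s l"
  shows "k = l"
proof -
  have "\<not> k < l" if "avalanche_stops \<mu> \<epsilon> s k" "avalanche_stops \<mu> \<epsilon> s l" for k l
  proof
    assume "k < l"
    then have "k + 1 \<in> {1..l}" by simp
    then show False using that unfolding avalanche_stops_def by fastforce
  qed
  then show ?thesis using assms by (metis linorder_neqE_nat)
qed

lemma full_avalanche_length_eq:
  assumes "avalanche_stops \<mu> \<epsilon> s k"
  shows "full_avalanche_length \<mu> \<epsilon> s = (\<Sum>i = 1..k. intertrading_time \<mu> s i)"
proof -
  have "(THE k. avalanche_stops \<mu> \<epsilon> s k) = k"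
    using assms avalanche_stops_unique by blast
  then show ?thesis using assms by (auto simp: full_avalanche_length_def)
qed

text \<open>A late first trade stops with \<open>k = 0\<close>. Otherwise the walk stops at
  \<open>Suc k\<close> exactly when the restarted walk stops at \<open>k\<close>; if neither ever
  stops, both lengths are infinite.\<close>

lemma full_avalanche_length_renewal:
  assumes mu: "\<mu> \<ge> 1" and unit: "\<And>n. \<bar>x n\<bar> = 1"
  shows "full_avalanche_length \<mu> \<epsilon> (walk x) =
    (if ereal_of_enat (first_trade \<mu> 0 x) \<le> ereal \<epsilon>
     then first_trade \<mu> 0 x
       + full_avalanche_length \<mu> \<epsilon> (walk (\<lambda>i. x (the_enat (first_trade \<mu> 0 x) + i)))
     else 0)"
proof (cases "ereal_of_enat (first_trade \<mu> 0 x) \<le> ereal \<epsilon>")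
  case False
  then have "avalanche_stops \<mu> \<epsilon> (walk x) 0"
    unfolding avalanche_stops_def using intertrading_time_1[OF mu unit] by simp
  from full_avalanche_length_eq[OF this] show ?thesis using False by simp
next
  case True
  then obtain t where t: "first_trade \<mu> 0 x = enat t"
    by (cases "first_trade \<mu> 0 x") auto
  note T = intertrading_time_1[OF mu unit]
  let ?s = "walk (\<lambda>i. x (t + i))"
  note stops_Suc = avalanche_stops_renewal[OF mu unit t, of \<epsilon>]
  show ?thesis
  proof (cases "\<exists>k. avalanche_stops \<mu> \<epsilon> ?s k")
    case ex: True
    then obtain k where k: "avalanche_stops \<mu> \<epsilon> ?s k" ..
    then have "avalanche_stops \<mu> \<epsilon> (walk x) (Suc k)"
      using True t by (simp add: stops_Suc)
    then have "full_avalanche_length \<mu> \<epsilon> (walk x) = (\<Sum>i = 1..Suc k. intertrading_time \<mu> (walk x) i)"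
      by (rule full_avalanche_length_eq)
    also have "\<dots> = intertrading_time \<mu> (walk x) 1 + (\<Sum>i = Suc 1..Suc k. intertrading_time \<mu> (walk x) i)"
      by (rule sum.atLeast_Suc_atMost) simp
    also have "\<dots> = first_trade \<mu> 0 x + (\<Sum>i = 1..k. intertrading_time \<mu> (walk x) (Suc i))"
      by (simp only: T sum.shift_bounds_cl_Suc_ivl)
    also have "(\<Sum>i = 1..k. intertrading_time \<mu> (walk x) (Suc i)) = (\<Sum>i = 1..k. intertrading_time \<mu> ?s i)"
      by (intro sum.cong intertrading_time_renewal[OF mu unit t]) auto
    also have "\<dots> = full_avalanche_length \<mu> \<epsilon> ?s"
      by (rule full_avalanche_length_eq[OF k, symmetric])
    finally show ?thesis using True t by simp
  next
    case False
    have "\<not> avalanche_stops \<mu> \<epsilon> (walk x) k" for k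
    proof (cases k)
      case 0
      then show ?thesis using True T by (simp add: avalanche_stops_def)
    qed (use False stops_Suc in simp)
    with False True t show ?thesis
      by (simp add: full_avalanche_length_def)
  qed
qed

text \<open>Times are integers or infinite, so the real threshold may be rounded down. The resulting
  natural number serves as the cutoff on which the renewal argument inducts.\<close>

lemma ereal_of_enat_le_iff_floor:
  assumes "\<epsilon> > 0"
  shows "ereal_of_enat N \<le> ereal \<epsilon> \<longleftrightarrow> N \<le> enat (nat \<lfloor>\<epsilon>\<rfloor>)"
  using assms by (cases N) (auto simp: le_nat_floor nat_le_iff le_floor_iff le_nat_iff)

subsection \<open>Measurability\<close>

text \<open>On each of the countably many level sets of \<open>f\<close> the first argument is
  fixed, and every function out of a discrete space is measurable; so \<open>h\<close> may be
  arbitrary.\<close>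

lemma measurable_count_space_binary:
  fixes f :: "'a \<Rightarrow> 'b::countable" and g :: "'a \<Rightarrow> 'c"
  assumes f: "f \<in> M \<rightarrow>\<^sub>M count_space UNIV" and g: "g \<in> M \<rightarrow>\<^sub>M count_space UNIV"
  shows "(\<lambda>x. h (f x) (g x)) \<in> M \<rightarrow>\<^sub>M count_space UNIV"
  by (rule measurable_compose_countable[OF _ f]) (rule measurable_compose[OF g], simp)

lemma measurable_INF_enat:
  assumes [measurable]: "\<And>n. Measurable.pred M (P n)"
  shows "(\<lambda>x. INF n\<in>{n. P n x}. enat n) \<in> M \<rightarrow>\<^sub>M count_space UNIV"
proof -
  have "(INF n\<in>{n. P n x}. enat n) = (if \<exists>n. P n x then enat (LEAST n. P n x) else \<infinity>)" for x
  proof (cases "\<exists>n. P n x")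
    case True
    have "(INF n\<in>{n. P n x}. enat n) = enat (LEAST n. P n x)"
    proof (rule antisym)
      show "(INF n\<in>{n. P n x}. enat n) \<le> enat (LEAST n. P n x)"
        using LeastI_ex[OF True] by (intro INF_lower) simp
      show "enat (LEAST n. P n x) \<le> (INF n\<in>{n. P n x}. enat n)"
        by (intro INF_greatest) (simp add: Least_le)
    qed
    then show ?thesis using True by simp
  qed (simp add: top_enat_def)
  moreover have "(\<lambda>x. enat (LEAST n. P n x)) \<in> M \<rightarrow>\<^sub>M count_space UNIV"
    by (rule measurable_compose[OF measurable_Least]) simp_all
  ultimately show ?thesis by simp
qed

section \<open>The space of independent fair steps\<close>

definition fair_steps :: "(nat \<Rightarrow> int) measure" where
  "fair_steps = PiM UNIV (\<lambda>_. measure_pmf (pmf_of_set {-1, 1}))"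

lemma space_fair_steps [simp]: "space fair_steps = UNIV"
  by (simp add: fair_steps_def space_PiM)

lemma sets_fair_steps: "sets fair_steps = sets (PiM UNIV (\<lambda>_. count_space UNIV))"
  unfolding fair_steps_def by (intro sets_PiM_cong) simp_all

lemma prob_space_fair_steps: "prob_space fair_steps"
  unfolding fair_steps_def by (intro prob_space_PiM prob_space_measure_pmf)

interpretation fair_steps: prob_space fair_steps
  by (rule prob_space_fair_steps)

lemma measurable_step [measurable]: "(\<lambda>x. x n) \<in> fair_steps \<rightarrow>\<^sub>M count_space UNIV"
  unfolding measurable_cong_sets[OF sets_fair_steps refl]
  by (rule measurable_component_singleton) simp

lemma measurable_fair_steps:
  assumes "\<And>n. (\<lambda>x. f x n) \<in> N \<rightarrow>\<^sub>M count_space UNIV"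
  shows "f \<in> N \<rightarrow>\<^sub>M fair_steps"
  unfolding measurable_cong_sets[OF refl sets_fair_steps]
  by (rule measurable_PiM_single') (use assms in auto)

lemma measurable_walk [measurable]: "(\<lambda>x. walk x n) \<in> fair_steps \<rightarrow>\<^sub>M count_space UNIV"
proof (induction n)
  case (Suc n)
  then show ?case
    using measurable_count_space_binary[OF Suc measurable_step[of n], of "(+)"] by simp
qed simp

lemma measurable_order_volume [measurable]:
  "(\<lambda>x. order_volume \<mu> (walk x) n u) \<in> fair_steps \<rightarrow>\<^sub>M count_space UNIV"
proof (induction n arbitrary: u)
  case (Suc n)
  show ?case
    using measurable_count_space_binary[OF measurable_walk[of n] Suc[of u],
        of "\<lambda>w v. if u = w then 0 else if u = w + \<mu> then v + 1 else v"]
    by simp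
qed simp

lemma measurable_trading_time [measurable]:
  "(\<lambda>x. trading_time \<mu> (walk x) i) \<in> fair_steps \<rightarrow>\<^sub>M count_space UNIV"
proof (induction i)
  case (Suc i)
  \<comment> \<open>The level \<open>walk x n\<close> is itself random, but it takes countably many
    values.\<close>
  have volume: "(\<lambda>x. order_volume \<mu> (walk x) n (walk x n)) \<in> fair_steps \<rightarrow>\<^sub>M count_space UNIV" for n
    by (rule measurable_compose_countable[OF measurable_order_volume measurable_walk])
  have "Measurable.pred fair_steps
      (\<lambda>x. trading_time \<mu> (walk x) i < enat n \<and> order_volume \<mu> (walk x) n (walk x n) > 0)" for n
    by (rule measurable_count_space_binary[OF Suc volume, of "\<lambda>t v. t < enat n \<and> v > 0" n])
  from measurable_INF_enat[where P = "\<lambda>n x. trading_time \<mu> (walk x) i < enat n \<and>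
      order_volume \<mu> (walk x) n (walk x n) > 0", OF this]
  show ?case unfolding trading_time.simps .
qed simp

lemma measurable_intertrading_time [measurable]:
  "(\<lambda>x. intertrading_time \<mu> (walk x) i) \<in> fair_steps \<rightarrow>\<^sub>M count_space UNIV"
  unfolding intertrading_time_def
  by (rule measurable_count_space_binary[where h = "(-)", OF measurable_trading_time measurable_trading_time])

lemma measurable_avalanche_stops [measurable]:
  "Measurable.pred fair_steps (\<lambda>x. avalanche_stops \<mu> \<epsilon> (walk x) k)"
proof -
  have [measurable]: "Measurable.pred fair_steps (\<lambda>x. P (intertrading_time \<mu> (walk x) i))" for P i
    by (rule measurable_compose[OF measurable_intertrading_time]) simp
  show ?thesis unfolding avalanche_stops_def by measurable
qed

lemma measurable_full_avalanche_length [measurable]: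
  "(\<lambda>x. full_avalanche_length \<mu> \<epsilon> (walk x)) \<in> fair_steps \<rightarrow>\<^sub>M count_space UNIV"
proof -
  \<comment> \<open>By uniqueness \<open>THE\<close> agrees with \<open>LEAST\<close>, which is
    known to be measurable.\<close>
  have eq: "full_avalanche_length \<mu> \<epsilon> s =
      (if \<exists>k. avalanche_stops \<mu> \<epsilon> s k
       then \<Sum>i = 1..(LEAST k. avalanche_stops \<mu> \<epsilon> s k). intertrading_time \<mu> s i else \<infinity>)" for s
  proof (cases "\<exists>k. avalanche_stops \<mu> \<epsilon> s k")
    case True
    then show ?thesis using full_avalanche_length_eq[OF LeastI_ex[OF True]] by simp
  next
    case False
    then show ?thesis by (simp only: full_avalanche_length_def if_False)
  qed
  have "(\<lambda>x. \<Sum>i = 1..k. intertrading_time \<mu> (walk x) i) \<in> fair_steps \<rightarrow>\<^sub>M count_space UNIV" for k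
  proof (induction k)
    case (Suc k)
    then have "(\<lambda>x. (\<Sum>i = 1..k. intertrading_time \<mu> (walk x) i) + intertrading_time \<mu> (walk x) (Suc k))
        \<in> fair_steps \<rightarrow>\<^sub>M count_space UNIV"
      by (rule measurable_count_space_binary[where h = "(+)", OF _ measurable_intertrading_time])
    then show ?case by simp
  qed simp
  then have [measurable]: "(\<lambda>x. \<Sum>i = 1..(LEAST k. avalanche_stops \<mu> \<epsilon> (walk x) k). intertrading_time \<mu> (walk x) i)
      \<in> fair_steps \<rightarrow>\<^sub>M count_space UNIV"
    by (rule measurable_compose_countable[OF _ measurable_Least]) simp
  show ?thesis unfolding eq by measurable
qed

lemma measurable_gap [measurable]: "(\<lambda>x. gap \<mu> d x n) \<in> fair_steps \<rightarrow>\<^sub>M count_space UNIV"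
proof (induction n)
  case (Suc n)
  then show ?case
    using measurable_count_space_binary[OF Suc measurable_step[of n], of "\<lambda>g y. min (max g 1) \<mu> - y"]
    by simp
qed simp

lemma measurable_first_trade [measurable]: "first_trade \<mu> d \<in> fair_steps \<rightarrow>\<^sub>M count_space UNIV"
  unfolding first_trade_def[abs_def] by (rule measurable_INF_enat) measurable

lemma measurable_shift: "(\<lambda>x i. x (t + i)) \<in> fair_steps \<rightarrow>\<^sub>M fair_steps"
  by (rule measurable_fair_steps) measurable

text \<open>The space contains all integer sequences; this allows the trajectory lemmas, which
  assume unit steps, to be used almost everywhere.\<close>

lemma AE_unit_steps: "AE x in fair_steps. \<forall>n. \<bar>x n\<bar> = 1"
  unfolding AE_all_countable fair_steps_def
proof
  fix n
  show "AE x in PiM UNIV (\<lambda>_::nat. measure_pmf (pmf_of_set {-1, 1::int})). \<bar>x n\<bar> = 1"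
    by (rule AE_PiM_component) (auto simp: prob_space_measure_pmf AE_measure_pmf_iff)
qed

subsection \<open>First-step analysis\<close>

lemma measurable_case_nat_fair_steps [measurable]: "case_nat y \<in> fair_steps \<rightarrow>\<^sub>M fair_steps"
  by (rule measurable_fair_steps) (auto split: nat.split)

text \<open>Prepending an independent fair step to a fair sequence gives a fair sequence again;
  Fubini then averages over the two values of that step.\<close>

lemma integral_first_step:
  fixes f :: "(nat \<Rightarrow> int) \<Rightarrow> complex"
  assumes f: "f \<in> borel_measurable fair_steps" and B: "\<And>x. norm (f x) \<le> B"
  shows "(LINT x|fair_steps. f x) =
    ((LINT x|fair_steps. f (case_nat 1 x)) + (LINT x|fair_steps. f (case_nat (-1) x))) / 2"
proof -
  let ?p = "measure_pmf (pmf_of_set {-1, 1::int})"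
  interpret sequence_space ?p
    by unfold_locales
  interpret pair: pair_prob_space ?p fair_steps
    by unfold_locales
  have iter: "distr (?p \<Otimes>\<^sub>M fair_steps) fair_steps (\<lambda>(y, x). case_nat y x) = fair_steps"
    using PiM_iter unfolding fair_steps_def .
  have meas: "(\<lambda>(y, x). case_nat y x) \<in> ?p \<Otimes>\<^sub>M fair_steps \<rightarrow>\<^sub>M fair_steps"
    unfolding fair_steps_def by measurable
  have int: "integrable (?p \<Otimes>\<^sub>M fair_steps) (\<lambda>(y, x). f (case_nat y x))"
    using measurable_compose[OF meas f] B
    by (intro pair.integrable_const_bound[of _ B]) (auto simp: case_prod_unfold)
  have "(LINT x|fair_steps. f x) = (LINT q|(?p \<Otimes>\<^sub>M fair_steps). f (case q of (y, x) \<Rightarrow> case_nat y x))"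
    by (subst iter[symmetric]) (rule integral_distr[OF meas f])
  also have "\<dots> = (LINT y|?p. LINT x|fair_steps. f (case_nat y x))"
    using pair.integral_fst'[OF int] by (simp add: case_prod_unfold)
  also have "\<dots> = (\<Sum>y\<in>{-1, 1}. pmf (pmf_of_set {-1, 1}) y *\<^sub>R (LINT x|fair_steps. f (case_nat y x)))"
    by (rule integral_measure_pmf) auto
  finally show ?thesis
    by (simp add: scaleR_conv_of_real field_simps)
qed

section \<open>Generating function of the first trading time\<close>

lemma enat_power_simps [simp]:
  "enat_power z 0 = 1" "enat_power z 1 = z" "enat_power z (enat n) = z ^ n" "enat_power z \<infinity> = 0"
  by (simp_all add: enat_power_def zero_enat_def one_enat_def)

lemma enat_power_add: "enat_power z (m + n) = enat_power z m * enat_power z n"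
  by (cases m; cases n) (simp_all add: power_add)

lemma enat_power_eSuc: "enat_power z (eSuc n) = z * enat_power z n"
  by (cases n) (simp_all add: eSuc_enat)

lemma norm_enat_power_le: "norm z \<le> 1 \<Longrightarrow> norm (enat_power z n) \<le> 1"
  by (cases n) (simp_all add: norm_power power_le_one)

lemma measurable_enat_power:
  "f \<in> M \<rightarrow>\<^sub>M count_space UNIV \<Longrightarrow> (\<lambda>x. enat_power z (f x)) \<in> borel_measurable M"
  by (erule measurable_compose) (rule borel_measurable_count_space)

lemma first_trade_pgf_step:
  assumes "\<mu> \<ge> 1" "norm z \<le> 1" "1 \<le> d" "d \<le> \<mu>"
  shows "(LINT x|fair_steps. enat_power z (first_trade \<mu> d x)) =
    z / 2 * ((if d = 1 then 1 else LINT x|fair_steps. enat_power z (first_trade \<mu> (d - 1) x))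
      + (LINT x|fair_steps. enat_power z (first_trade \<mu> (d + 1) x)))"
proof -
  have c: "min (max d 1) \<mu> = d" using assms by auto
  have up: "enat_power z (first_trade \<mu> d (case_nat 1 x)) =
      z * (if d = 1 then 1 else enat_power z (first_trade \<mu> (d - 1) x))" for x
    by (simp add: first_trade_case_nat c enat_power_eSuc)
  \<comment> \<open>After a down-step the gap is \<open>d + 1 > 0\<close>, so no trade can
    occur.\<close>
  have down: "enat_power z (first_trade \<mu> d (case_nat (-1) x)) =
      z * enat_power z (first_trade \<mu> (d + 1) x)" for x
    using assms by (simp add: first_trade_case_nat c enat_power_eSuc)
  show ?thesis
    by (subst integral_first_step[where B = 1])
       (use assms in \<open>auto simp: up down norm_enat_power_le field_simps fair_steps.prob_space[simplified]
          intro: measurable_enat_power\<close>)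
qed

lemma first_trade_pgf:
  assumes mu: "\<mu> = int (Suc m)" and z: "norm z \<le> 1"
  shows "(LINT x|fair_steps. enat_power z (first_trade \<mu> 0 x)) =
    z / 2 * continuant 1 (z / 2) m / continuant 1 (z / 2) (Suc m)"
proof -
  define G where "G d = (LINT x|fair_steps. enat_power z (first_trade \<mu> d x))" for d
  \<comment> \<open>The value 1 at index 0 stands for a trade that has just occurred. It is not to
    be confused with \<open>G 0\<close>, which starts afresh and equals \<open>G 1\<close> by
    clamping.\<close>
  define f where "f e = (if e = 0 then 1 else G (int e))" for e :: nat
  have mu1: "\<mu> \<ge> 1" using mu by simp
  have clamp: "G (min (max d 1) \<mu>) = G d" for d
    unfolding G_def first_trade_clamp[OF mu1] ..
  have "f 1 * continuant 1 (z / 2) (Suc m) = z / 2 * f 0 * continuant 1 (z / 2) m"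
  proof (rule harmonic_chain_ratio)
    fix e assume "e \<le> m"
    have shift: "int (Suc e) - 1 = int e" "int (Suc e) + 1 = int (Suc (Suc e))" by simp_all
    have "G (int (Suc e)) = z / 2 * ((if int (Suc e) = 1 then 1 else G (int (Suc e) - 1)) + G (int (Suc e) + 1))"
      unfolding G_def using z mu \<open>e \<le> m\<close> by (intro first_trade_pgf_step) auto
    then show "f (Suc e) = z / 2 * (f e + f (Suc (Suc e)))"
      unfolding f_def shift by simp
  next
    \<comment> \<open>Gap \<open>\<mu> + 1\<close> clamps to \<open>\<mu>\<close>: this is
      reflection, with \<open>c = 1\<close>.\<close>
    show "f (Suc (Suc m)) = 1 * f (Suc m)"
      using clamp[of "\<mu> + 1"] mu by (simp add: f_def min_def max_def add.commute)
  qed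
  moreover have "f 0 = 1" by (simp add: f_def)
  moreover have "f 1 = G 0" using clamp[of 0] mu1 by (simp add: f_def)
  moreover have "continuant 1 (z / 2) (Suc m) \<noteq> 0"
    using z by (intro continuant_nonzero) (auto simp: norm_divide)
  ultimately show ?thesis by (simp add: G_def field_simps)
qed

section \<open>Strong Markov property at the first trade\<close>

text \<open>\<open>g\<close> sees only the steps after the first trade. The cutoff \<open>m\<close>
  allows induction; for constant \<open>g = 1\<close> the mean is the truncated generating
  function.\<close>

definition renewal_term ::
    "int \<Rightarrow> complex \<Rightarrow> ((nat \<Rightarrow> int) \<Rightarrow> complex) \<Rightarrow> int \<Rightarrow> nat \<Rightarrow> (nat \<Rightarrow> int) \<Rightarrow> complex" where
  "renewal_term \<mu> z g d m x =
     (if first_trade \<mu> d x \<le> enat m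
      then enat_power z (first_trade \<mu> d x) * g (\<lambda>i. x (the_enat (first_trade \<mu> d x) + i)) else 0)"

lemma renewal_term_case_nat:
  "renewal_term \<mu> z g d (Suc m) (case_nat y x) =
     z * (if min (max d 1) \<mu> = y then g x else renewal_term \<mu> z g (min (max d 1) \<mu> - y) m x)"
proof (cases "min (max d 1) \<mu> = y")
  case True
  then show ?thesis
    by (simp add: renewal_term_def first_trade_case_nat one_enat_def)
next
  case False
  then show ?thesis
    by (cases "first_trade \<mu> (min (max d 1) \<mu> - y) x")
       (auto simp: renewal_term_def first_trade_case_nat enat_power_eSuc eSuc_enat)
qed

lemma renewal_term_0 [simp]: "renewal_term \<mu> z g d 0 = (\<lambda>_. 0)"
proof
  fix x
  have "enat 1 \<le> first_trade \<mu> d x"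
    unfolding first_trade_def by (rule INF_greatest) auto
  then have "\<not> first_trade \<mu> d x \<le> enat 0"
    by (cases "first_trade \<mu> d x") auto
  then show "renewal_term \<mu> z g d 0 x = 0" by (simp add: renewal_term_def)
qed

context
  fixes \<mu> :: int and z :: complex
  assumes mu: "\<mu> \<ge> 1" and z: "norm z \<le> 1"
begin

lemma norm_renewal_term_le:
  assumes "\<And>x. norm (g x) \<le> 1"
  shows "norm (renewal_term \<mu> z g d m x) \<le> 1"
  using mult_mono[OF norm_enat_power_le[OF z] assms] by (simp add: renewal_term_def norm_mult)

lemma measurable_renewal_term:
  assumes "g \<in> borel_measurable fair_steps"
  shows "renewal_term \<mu> z g d m \<in> borel_measurable fair_steps"
proof -
  have "(\<lambda>x. (\<lambda>n x. if n \<le> enat m then enat_power z n * g (\<lambda>i. x (the_enat n + i)) else 0)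
      (first_trade \<mu> d x) x) \<in> borel_measurable fair_steps"
  proof (rule measurable_compose_countable[OF _ measurable_first_trade])
    fix n
    show "(\<lambda>x. if n \<le> enat m then enat_power z n * g (\<lambda>i. x (the_enat n + i)) else 0) \<in> borel_measurable fair_steps"
      using measurable_compose[OF measurable_shift assms] by auto
  qed
  then show ?thesis unfolding renewal_term_def[abs_def] .
qed

lemma integral_renewal_term_Suc:
  fixes d :: int
  assumes g: "g \<in> borel_measurable fair_steps" "\<And>x. norm (g x) \<le> 1"
  defines "c \<equiv> min (max d 1) \<mu>"
  shows "(LINT x|fair_steps. renewal_term \<mu> z g d (Suc m) x) =
    z / 2 * ((if c = 1 then LINT x|fair_steps. g x
              else LINT x|fair_steps. renewal_term \<mu> z g (c - 1) m x)
             + (LINT x|fair_steps. renewal_term \<mu> z g (c + 1) m x))"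
proof -
  have "c \<noteq> -1" using mu by (auto simp: c_def min_def max_def)
  then show ?thesis
    by (subst integral_first_step[where B = 1])
       (auto simp: renewal_term_case_nat[of \<mu> z g d, folded c_def] norm_renewal_term_le g field_simps
          intro: measurable_renewal_term)
qed

text \<open>Induction on the cutoff replaces a stopping-time argument: both sides obey the same
  first-step recurrence, and the mean of \<open>g\<close> splits off at the step on which the trade
  occurs.\<close>

lemma integral_renewal_term:
  assumes g: "g \<in> borel_measurable fair_steps" "\<And>x. norm (g x) \<le> 1"
  shows "(LINT x|fair_steps. renewal_term \<mu> z g d m x) =
    (LINT x|fair_steps. renewal_term \<mu> z (\<lambda>_. 1) d m x) * (LINT x|fair_steps. g x)"
proof (induction m arbitrary: d)
  case (Suc m)
  show ?case
    unfolding integral_renewal_term_Suc[OF g]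
    by (subst integral_renewal_term_Suc) (auto simp: Suc fair_steps.prob_space[simplified] algebra_simps)
qed simp

text \<open>The bound solves \<open>b (Suc m) = (1 + b m) / 2\<close> with \<open>b 0 = 0\<close>:
  an up-step contributes at most 1, a down-step the previous bound. The missing
  \<open>1 / 2 ^ m\<close> is the probability of \<open>m\<close> consecutive down-steps.\<close>

lemma norm_integral_renewal_term_le:
  "norm (LINT x|fair_steps. renewal_term \<mu> z (\<lambda>_. 1) d m x) \<le> 1 - 1 / 2 ^ m"
proof (induction m arbitrary: d)
  case (Suc m)
  let ?Q = "\<lambda>d m. LINT x|fair_steps. renewal_term \<mu> z (\<lambda>_. 1) d m x"
  let ?c = "min (max d 1) \<mu>"
  let ?A = "if ?c = 1 then 1 else ?Q (?c - 1) m"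
  have "?Q d (Suc m) = z / 2 * (?A + ?Q (?c + 1) m)"
    by (subst integral_renewal_term_Suc) (auto simp: fair_steps.prob_space[simplified])
  moreover have "norm (?A + ?Q (?c + 1) m) \<le> 1 + (1 - 1 / 2 ^ m)"
  proof (rule order_trans[OF norm_triangle_ineq add_mono])
    show "norm ?A \<le> 1"
      using Suc[of "?c - 1"] by (auto intro: order_trans)
  qed (rule Suc)
  then have "norm (z / 2 * (?A + ?Q (?c + 1) m)) \<le> 1 / 2 * (1 + (1 - 1 / 2 ^ m))"
    unfolding norm_mult using z by (intro mult_mono) (auto simp: norm_divide)
  ultimately have "norm (?Q d (Suc m)) \<le> 1 / 2 * (1 + (1 - 1 / 2 ^ m))"
    by metis
  then show ?case by simp
qed simp

end

subsection \<open>The avalanche length\<close>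

text \<open>Averaging the pathwise renewal equation gives the desired mean times
  \<open>1 - q\<close> equal to \<open>p\<close>. The short and long events are complementary, so
  the denominator claimed is \<open>1 - q\<close>, nonzero because
  \<open>norm q < 1\<close>.\<close>

lemma avalanche_pgf_fair_steps:
  fixes \<mu> :: int and \<epsilon> :: real and z :: complex
  assumes mu: "\<mu> \<ge> 1" and eps: "\<epsilon> > 0" and z: "norm z \<le> 1"
  defines "L \<equiv> \<lambda>x. full_avalanche_length \<mu> \<epsilon> (walk x)"
    and "T \<equiv> \<lambda>x. intertrading_time \<mu> (walk x) 1"
  defines "p \<equiv> of_real (measure fair_steps {x. ereal_of_enat (T x) > ereal \<epsilon>}) :: complex"
  shows "(LINT x|fair_steps. enat_power z (L x)) =
    p / ((LINT x:{x. ereal_of_enat (T x) \<le> ereal \<epsilon>}|fair_steps. 1 - enat_power z (T x)) + p)"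
proof -
  define m where "m = nat \<lfloor>\<epsilon>\<rfloor>"
  let ?g = "\<lambda>x. enat_power z (L x)"
  let ?short = "{x. ereal_of_enat (T x) \<le> ereal \<epsilon>}"
  let ?long = "{x. ereal_of_enat (T x) > ereal \<epsilon>}"
  have [measurable]: "T \<in> fair_steps \<rightarrow>\<^sub>M count_space UNIV" "L \<in> fair_steps \<rightarrow>\<^sub>M count_space UNIV"
    unfolding T_def L_def by (rule measurable_intertrading_time measurable_full_avalanche_length)+
  have [measurable]: "(\<lambda>x. enat_power z (T x)) \<in> borel_measurable fair_steps"
      "?g \<in> borel_measurable fair_steps"
    by (rule measurable_enat_power, measurable)+
  have event: "Measurable.pred fair_steps (\<lambda>x. P (T x))" for P
    by (rule measurable_compose[OF \<open>T \<in> _\<close>]) simp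
  have [measurable]: "?short \<in> sets fair_steps" "?long \<in> sets fair_steps"
    using event[of "\<lambda>N. ereal_of_enat N \<le> ereal \<epsilon>"] event[of "\<lambda>N. ereal_of_enat N > ereal \<epsilon>"]
    by (simp_all add: pred_def)
  have short_int: "integrable fair_steps (\<lambda>x. indicator ?short x :: complex)"
    by (intro fair_steps.integrable_const_bound[of _ 1]) (auto simp: indicator_def)
  have long_int: "integrable fair_steps (\<lambda>x. indicator ?long x :: complex)"
    by (intro fair_steps.integrable_const_bound[of _ 1]) (auto simp: indicator_def)
  define q where "q = (LINT x|fair_steps. renewal_term \<mu> z (\<lambda>_. 1) 0 m x)"
  have bound: "norm (?g x) \<le> 1" for x
    using z by (rule norm_enat_power_le)
  have term_int: "integrable fair_steps (renewal_term \<mu> z g 0 m)"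
    if "g \<in> borel_measurable fair_steps" "\<And>x. norm (g x) \<le> 1" for g
    using norm_renewal_term_le[OF mu z that(2)] measurable_renewal_term[OF mu z that(1)]
    by (intro fair_steps.integrable_const_bound[of _ 1]) auto
  have T_AE: "AE x in fair_steps. T x = first_trade \<mu> 0 x \<and>
      (ereal_of_enat (T x) \<le> ereal \<epsilon> \<longleftrightarrow> first_trade \<mu> 0 x \<le> enat m)"
    using AE_unit_steps
  proof eventually_elim
    case (elim x)
    then show ?case
      using intertrading_time_1[OF mu, of x] ereal_of_enat_le_iff_floor[OF eps]
      by (simp add: T_def m_def)
  qed
  have p: "p = (LINT x|fair_steps. indicator ?long x)"
  proof -
    have "(LINT x|fair_steps. indicator ?long x :: complex) =
        (LINT x|fair_steps. complex_of_real (indicator ?long x))"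
      by (rule Bochner_Integration.integral_cong) (auto simp: indicator_def)
    then show ?thesis
      by (simp only: integral_complex_of_real) (simp add: p_def)
  qed
  \<comment> \<open>A late first trade makes the length 0, hence \<open>?g x = 1\<close>; the
    indicator of \<open>?long\<close> accounts for this case.\<close>
  have "(LINT x|fair_steps. ?g x) = (LINT x|fair_steps. renewal_term \<mu> z ?g 0 m x + indicator ?long x)"
  proof (rule integral_cong_AE)
    show "AE x in fair_steps. ?g x = renewal_term \<mu> z ?g 0 m x + indicator ?long x"
      using T_AE AE_unit_steps
    proof eventually_elim
      case (elim x)
      then show ?case
        using full_avalanche_length_renewal[OF mu, of x \<epsilon>]
        by (auto simp: L_def renewal_term_def enat_power_add indicator_def not_le[symmetric])
    qed
  qed (use measurable_renewal_term[OF mu z] in measurable)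
  also have "\<dots> = (LINT x|fair_steps. renewal_term \<mu> z ?g 0 m x) + p"
    unfolding p by (intro Bochner_Integration.integral_add term_int long_int bound) measurable
  also have "(LINT x|fair_steps. renewal_term \<mu> z ?g 0 m x) = q * (LINT x|fair_steps. ?g x)"
    unfolding q_def by (rule integral_renewal_term[OF mu z _ bound]) measurable
  finally have "(LINT x|fair_steps. ?g x) - q * (LINT x|fair_steps. ?g x) = p"
    by (subst diff_eq_eq, subst add.commute)
  then have renewal: "(LINT x|fair_steps. ?g x) * (1 - q) = p"
    by (simp add: algebra_simps)
  have "norm q < 1"
  proof -
    have "norm q \<le> 1 - 1 / 2 ^ m"
      unfolding q_def by (rule norm_integral_renewal_term_le[OF mu z])
    also have "\<dots> < 1" by simp
    finally show ?thesis .
  qed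
  then have "1 - q \<noteq> 0" by auto
  have "(LINT x:?short|fair_steps. 1 - enat_power z (T x)) =
      (LINT x|fair_steps. indicator ?short x - renewal_term \<mu> z (\<lambda>_. 1) 0 m x)"
    unfolding set_lebesgue_integral_def
  proof (rule integral_cong_AE)
    show "AE x in fair_steps. indicator ?short x *\<^sub>R (1 - enat_power z (T x)) =
        indicator ?short x - renewal_term \<mu> z (\<lambda>_. 1) 0 m x"
      using T_AE by eventually_elim (auto simp: renewal_term_def indicator_def)
  qed (use measurable_renewal_term[OF mu z] in measurable)
  also have "\<dots> = (LINT x|fair_steps. indicator ?short x) - q"
    unfolding q_def by (intro Bochner_Integration.integral_diff term_int short_int) auto
  finally have short:
    "(LINT x:?short|fair_steps. 1 - enat_power z (T x)) = (LINT x|fair_steps. indicator ?short x) - q" .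
  have "(LINT x|fair_steps. indicator ?short x) + p = (1 :: complex)"
  proof -
    have "(LINT x|fair_steps. indicator ?short x) + p =
        (LINT x|fair_steps. indicator ?short x + indicator ?long x :: complex)"
      unfolding p by (rule Bochner_Integration.integral_add[symmetric, OF short_int long_int])
    also have "(\<lambda>x. indicator ?short x + indicator ?long x :: complex) = (\<lambda>_. 1)"
      by (auto simp: indicator_def fun_eq_iff)
    finally show ?thesis by (simp add: fair_steps.prob_space[simplified])
  qed
  then have "(LINT x:?short|fair_steps. 1 - enat_power z (T x)) + p = 1 - q"
    unfolding short by (simp add: algebra_simps)
  moreover have "(LINT x|fair_steps. ?g x) = p / (1 - q)"
    using renewal \<open>1 - q \<noteq> 0\<close> by (simp add: eq_divide_eq)
  ultimately show ?thesis by (simp only:)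
qed

text \<open>Both sides are the same quotient of continuants, one by first-step analysis and the
  other by the Wronskian identity.\<close>

lemma intertrading_time_pgf_fair_steps:
  assumes mu: "\<mu> \<ge> 1" and z: "norm z \<le> 1"
  shows "(LINT x|fair_steps. enat_power z (intertrading_time \<mu> (walk x) 1)) =
    gf_A \<mu> z + gf_B \<mu> z / (1 - gf_B \<mu> z) * gf_C \<mu> z"
proof -
  obtain m where m: "\<mu> = int (Suc m)"
  proof
    show "\<mu> = int (Suc (nat (\<mu> - 1)))" using mu by simp
  qed
  have "(LINT x|fair_steps. enat_power z (intertrading_time \<mu> (walk x) 1)) =
      (LINT x|fair_steps. enat_power z (first_trade \<mu> 0 x))"
  proof (rule integral_cong_AE)
    show "AE x in fair_steps. enat_power z (intertrading_time \<mu> (walk x) 1) = enat_power z (first_trade \<mu> 0 x)"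
      using AE_unit_steps by eventually_elim (simp only: intertrading_time_1[OF mu])
  qed (rule measurable_enat_power, measurable)+
  then show ?thesis
    using first_trade_pgf[OF m z] avalanche_gf_identity[OF m z] by simp
qed

section \<open>Transfer to the given random walk\<close>

context simple_symmetric_random_walk
begin

definition steps :: "'a \<Rightarrow> nat \<Rightarrow> int" where
  "steps \<omega> n = S (Suc n) \<omega> - S n \<omega>"

lemma walk_steps: "\<omega> \<in> space M \<Longrightarrow> (\<lambda>n. S n \<omega>) = walk (steps \<omega>)"
proof
  fix n assume "\<omega> \<in> space M"
  then show "S n \<omega> = walk (steps \<omega>) n"
    by (induction n) (simp_all add: start steps_def)
qed

lemma measurable_steps [measurable]: "steps \<in> M \<rightarrow>\<^sub>M fair_steps"
proof (rule measurable_fair_steps)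
  show "(\<lambda>\<omega>. steps \<omega> n) \<in> M \<rightarrow>\<^sub>M count_space UNIV" for n
    using indep_steps unfolding indep_vars_def steps_def by auto
qed

text \<open>Independence of the increments says that their joint law is the product of the
  marginals, and each marginal is fair.\<close>

lemma distr_steps_eq: "distr M fair_steps steps = fair_steps"
proof -
  have "distr M fair_steps steps = distr M (PiM UNIV (\<lambda>_. count_space UNIV)) steps"
    by (rule distr_cong) (simp_all add: sets_fair_steps)
  also have "\<dots> = distr M (PiM UNIV (\<lambda>_. count_space UNIV)) (\<lambda>\<omega>. \<lambda>n\<in>UNIV. S (Suc n) \<omega> - S n \<omega>)"
    by (rule distr_cong) (simp_all add: steps_def fun_eq_iff)
  also have "\<dots> = PiM UNIV (\<lambda>n. distr M (count_space UNIV) (\<lambda>\<omega>. S (Suc n) \<omega> - S n \<omega>))"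
    using indep_steps
    by (subst indep_vars_iff_distr_eq_PiM[symmetric]) (auto simp: indep_vars_def)
  also have "\<dots> = fair_steps"
    by (simp add: distr_steps fair_steps_def)
  finally show ?thesis .
qed

lemma integral_walk:
  fixes f :: "(nat \<Rightarrow> int) \<Rightarrow> complex"
  assumes "(\<lambda>x. f (walk x)) \<in> borel_measurable fair_steps"
  shows "(LINT \<omega>|M. f (\<lambda>n. S n \<omega>)) = (LINT x|fair_steps. f (walk x))"
proof -
  have "(LINT \<omega>|M. f (\<lambda>n. S n \<omega>)) = (LINT \<omega>|M. f (walk (steps \<omega>)))"
    by (rule Bochner_Integration.integral_cong) (simp_all add: walk_steps)
  also have "\<dots> = (LINT x|distr M fair_steps steps. f (walk x))"
    by (rule integral_distr[symmetric, OF measurable_steps assms])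
  finally show ?thesis by (simp add: distr_steps_eq)
qed

lemma measure_walk:
  assumes "{x. P (walk x)} \<in> sets fair_steps"
  shows "measure M {\<omega> \<in> space M. P (\<lambda>n. S n \<omega>)} = measure fair_steps {x. P (walk x)}"
proof -
  have "{\<omega> \<in> space M. P (\<lambda>n. S n \<omega>)} = steps -` {x. P (walk x)} \<inter> space M"
    using walk_steps by auto
  then show ?thesis
    using measure_distr[OF measurable_steps assms] by (simp add: distr_steps_eq)
qed

end

theorem theorem2:
  fixes M :: "'a measure" and S :: "nat \<Rightarrow> 'a \<Rightarrow> int"
    and \<mu> :: int and \<epsilon> :: real
    and L T1 :: "'a \<Rightarrow> enat"
  assumes walk: "simple_symmetric_random_walk M S"
    and mu: "\<mu> \<ge> 1" and eps: "\<epsilon> > 0"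
  defines "L \<equiv> \<lambda>\<omega>. full_avalanche_length \<mu> \<epsilon> (\<lambda>n. S n \<omega>)"
    and "T1 \<equiv> \<lambda>\<omega>. intertrading_time \<mu> (\<lambda>n. S n \<omega>) 1"
  shows "(\<forall>z::complex. norm z \<le> 1 \<longrightarrow>
           (LINT \<omega>|M. enat_power z (L \<omega>)) =
             of_real (measure M {\<omega> \<in> space M. ereal_of_enat (T1 \<omega>) > ereal \<epsilon>}) /
             ((LINT \<omega>:{\<omega> \<in> space M. ereal_of_enat (T1 \<omega>) \<le> ereal \<epsilon>}|M. 1 - enat_power z (T1 \<omega>))
              + of_real (measure M {\<omega> \<in> space M. ereal_of_enat (T1 \<omega>) > ereal \<epsilon>}))) \<and>
         (\<forall>z::complex. norm z \<le> 1 \<longrightarrow>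
           (LINT \<omega>|M. enat_power z (T1 \<omega>)) =
             gf_A \<mu> z + gf_B \<mu> z / (1 - gf_B \<mu> z) * gf_C \<mu> z)"
proof -
  interpret simple_symmetric_random_walk M S by (rule walk)
  let ?T = "\<lambda>s. intertrading_time \<mu> s 1" and ?L = "full_avalanche_length \<mu> \<epsilon>"
  have T_meas: "(\<lambda>x. P (?T (walk x))) \<in> fair_steps \<rightarrow>\<^sub>M count_space UNIV" for P :: "enat \<Rightarrow> bool"
    by (rule measurable_compose[OF measurable_intertrading_time]) simp
  have pgf_T: "(LINT \<omega>|M. enat_power z (T1 \<omega>)) = (LINT x|fair_steps. enat_power z (?T (walk x)))" for z
    unfolding T1_def
    by (rule integral_walk[of "\<lambda>s. enat_power z (?T s)"])
       (rule measurable_enat_power[OF measurable_intertrading_time])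
  have pgf_L: "(LINT \<omega>|M. enat_power z (L \<omega>)) = (LINT x|fair_steps. enat_power z (?L (walk x)))" for z
    unfolding L_def
    by (rule integral_walk[of "\<lambda>s. enat_power z (?L s)"])
       (rule measurable_enat_power[OF measurable_full_avalanche_length])
  have long: "measure M {\<omega> \<in> space M. ereal_of_enat (T1 \<omega>) > ereal \<epsilon>} =
      measure fair_steps {x. ereal_of_enat (?T (walk x)) > ereal \<epsilon>}"
    unfolding T1_def
    by (rule measure_walk[of "\<lambda>s. ereal_of_enat (?T s) > ereal \<epsilon>"])
       (use T_meas[of "\<lambda>N. ereal_of_enat N > ereal \<epsilon>"] in \<open>simp add: pred_def\<close>)
  \<comment> \<open>The set integral is rewritten with an indicator over trajectories, so that it
    becomes the mean of a function of the walk alone.\<close>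
  let ?h = "\<lambda>z s. indicator {s. ereal_of_enat (?T s) \<le> ereal \<epsilon>} s *\<^sub>R (1 - enat_power z (?T s)) :: complex"
  have short: "(LINT \<omega>:{\<omega> \<in> space M. ereal_of_enat (T1 \<omega>) \<le> ereal \<epsilon>}|M. 1 - enat_power z (T1 \<omega>)) =
      (LINT x:{x. ereal_of_enat (?T (walk x)) \<le> ereal \<epsilon>}|fair_steps. 1 - enat_power z (?T (walk x)))" for z
  proof -
    have "(LINT \<omega>:{\<omega> \<in> space M. ereal_of_enat (T1 \<omega>) \<le> ereal \<epsilon>}|M. 1 - enat_power z (T1 \<omega>)) =
        (LINT \<omega>|M. ?h z (\<lambda>n. S n \<omega>))"
      unfolding set_lebesgue_integral_def T1_def
      by (rule Bochner_Integration.integral_cong) (auto simp: indicator_def)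
    also have "\<dots> = (LINT x|fair_steps. ?h z (walk x))"
    proof (rule integral_walk)
      have "(\<lambda>x. (\<lambda>N. indicator {N. ereal_of_enat N \<le> ereal \<epsilon>} N *\<^sub>R (1 - enat_power z N)) (?T (walk x)))
          \<in> borel_measurable fair_steps"
        by (rule measurable_compose[OF measurable_intertrading_time]) simp
      then show "(\<lambda>x. ?h z (walk x)) \<in> borel_measurable fair_steps"
        by (simp add: indicator_def)
    qed
    finally show ?thesis
      by (simp add: set_lebesgue_integral_def indicator_def)
  qed
  show ?thesis
    unfolding pgf_T pgf_L long short
    using avalanche_pgf_fair_steps[OF mu eps] intertrading_time_pgf_fair_steps[OF mu] by blast
qed

end
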